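(* Let $C\ge 1$ and let $X_1,\dots,X_n$ be i.i.d. nonnegative random variables. Then Budgeted Greedy with parameter $\gamma=\sqrt2$, denoted $\mathrm{ALG}$, minimizes the expected number of opened bins among all risk-budgeted policies with risk budget $\sqrt2/C$, i.e. $\mathbf{E}[N_{\mathrm{ALG}}]\le\mathbf{E}[N_{\mathcal{P}}]$ for every such policy $\mathcal{P}$. As a consequence, \[ \mathrm{cost}(\mathrm{ALG})\le(3+2\sqrt2)\,\mathrm{cost}(\mathrm{OPT}), \] where $\mathrm{OPT}$ denotes the optimal policy that knows $n$ in advance.
   Context: Model. $C\ge 1$ is a penalty parameter. The items are independent nonnegative random variables $X_1,\dots,X_n$, and there are unit-capacity bins $B_1,\dots,B_n$. Items are packed sequentially in the order $1,\dots,n$: at round $i$ a (deterministic) policy, which may know $n$ and all distributions in advance, chooses the bin $j\in\{1,\dots,n\}$ for item $i$ (written $i\to j$) as a function of the history (the bins chosen for and the realized sizes of items $1,\dots,i-1$); then the size of $X_i$ is revealed. The usage $S_j^{i-1}$ is the sum of the realized sizes of the items among $1,\dots,i-1$ packed into bin $j$. A bin is overflowed (broken) once its usage exceeds $1$; a policy is feasible if it never packs an item into an already overflowed bin, and only feasible policies are considered. A bin is opened when it receives its first item. $N_{\mathcal{P}}$ is the number of bins opened, $O_{\mathcal{P}}$ the number of bins overflowed, $\mathrm{cost}(\mathcal{P})=\mathbf{E}[N_{\mathcal{P}}]+C\,\mathbf{E}[O_{\mathcal{P}}]$, and $\mathrm{cost}(\mathrm{OPT})=\inf_{\mathcal{P}}\mathrm{cost}(\mathcal{P})$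 over all policies. The risk of bin $B_j$ is $\mathrm{Risk}(B_j)=\sum_{i=1}^n \Pr_{X_i}(X_i+S_j^{i-1}>1)\,\mathbf{1}_{\{i\to j\}}$ (a random variable; $\Pr_{X_i}$ is over $X_i$ only, with $S_j^{i-1}$ fixed). A policy is risk-budgeted with risk budget $r>0$ if $\mathrm{Risk}(B_j)\le r$ for every $j$. Budgeted Greedy with parameter $\gamma\ge1$ is the following online algorithm. It keeps for each open bin $j$ its usage $S_j^{i-1}$ and accumulated risk $r_j^{i-1}$. Write $p_i(s)=\Pr(X_i+s>1)$. When item $i$ arrives, if there is an open bin $j$ that is not overflowed (usage at most $1$) with $r_j^{i-1}+p_i(S_j^{i-1})\le\gamma/C$, item $i$ is packed into such a bin (ties broken arbitrarily) and $r_j^i=r_j^{i-1}+p_i(S_j^{i-1})$; otherwise a new bin $k$ is opened for item $i$, with $r_k^i=p_i(0)$. The risks of the other bins do not change. *)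

theory Defs
  imports "HOL-Probability.Probability"
begin

text \<open>
  Items and bins are both numbered \<open>1, \<dots>, n\<close>.  A deterministic policy maps the history, i.e. the
  chronological list of pairs (chosen bin, realized size), to the bin for the next item.  In the
  definitions by path, \<open>x k\<close> is the realized size of item \<open>k\<close>.
\<close>

type_synonym policy = "(nat \<times> real) list \<Rightarrow> nat"

primrec hist :: "policy \<Rightarrow> (nat \<Rightarrow> real) \<Rightarrow> nat \<Rightarrow> (nat \<times> real) list" where
  "hist P x 0 = []"
| "hist P x (Suc i) = hist P x i @ [(P (hist P x i), x (Suc i))]"

definition bin_of :: "policy \<Rightarrow> (nat \<Rightarrow> real) \<Rightarrow> nat \<Rightarrow> nat" where
  "bin_of P x i = P (hist P x (i - 1))"

definition items_in :: "policy \<Rightarrow> (nat \<Rightarrow> real) \<Rightarrow> nat \<Rightarrow> nat \<Rightarrow> nat set" where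
  "items_in P x i j = {k \<in> {1..i}. bin_of P x k = j}"

text \<open>The usage \<open>S\<^sub>j\<^sup>i\<close>, after the first \<open>i\<close> items.\<close>

definition usage :: "policy \<Rightarrow> (nat \<Rightarrow> real) \<Rightarrow> nat \<Rightarrow> nat \<Rightarrow> real" where
  "usage P x i j = (\<Sum>k\<in>items_in P x i j. x k)"

definition is_open :: "policy \<Rightarrow> (nat \<Rightarrow> real) \<Rightarrow> nat \<Rightarrow> nat \<Rightarrow> bool" where
  "is_open P x i j \<longleftrightarrow> items_in P x i j \<noteq> {}"

definition overflowed :: "policy \<Rightarrow> (nat \<Rightarrow> real) \<Rightarrow> nat \<Rightarrow> nat \<Rightarrow> bool" where
  "overflowed P x i j \<longleftrightarrow> usage P x i j > 1"

definition num_opened :: "policy \<Rightarrow> nat \<Rightarrow> (nat \<Rightarrow> real) \<Rightarrow> nat" where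
  "num_opened P n x = card {j \<in> {1..n}. is_open P x n j}"

definition num_overflowed :: "policy \<Rightarrow> nat \<Rightarrow> (nat \<Rightarrow> real) \<Rightarrow> nat" where
  "num_overflowed P n x = card {j \<in> {1..n}. overflowed P x n j}"

text \<open>\<open>p\<^sub>i(s) = Pr(X\<^sub>i + s > 1)\<close>, with \<open>s\<close> fixed.\<close>

definition overflow_prob :: "'a measure \<Rightarrow> (nat \<Rightarrow> 'a \<Rightarrow> real) \<Rightarrow> nat \<Rightarrow> real \<Rightarrow> real" where
  "overflow_prob M X i s = measure M {\<omega> \<in> space M. X i \<omega> + s > 1}"

text \<open>
  The risk accumulated by bin \<open>j\<close> over the first \<open>i\<close> items; \<open>Risk(B\<^sub>j)\<close> is the value at \<open>i = n\<close>, and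
  the risk \<open>r\<^sub>j\<^sup>i\<close> that Budgeted Greedy updates step by step is this sum (a new bin has usage 0).
\<close>

definition risk ::
  "'a measure \<Rightarrow> (nat \<Rightarrow> 'a \<Rightarrow> real) \<Rightarrow> policy \<Rightarrow> (nat \<Rightarrow> real) \<Rightarrow> nat \<Rightarrow> nat \<Rightarrow> real" where
  "risk M X P x i j = (\<Sum>k\<in>items_in P x i j. overflow_prob M X k (usage P x (k - 1) j))"

text \<open>
  Each decision has to be a Borel function of the sizes seen so far.  Measurability of the chosen
  bins with respect to \<open>M\<close> alone would not do: a non-Borel function of \<open>X\<^sub>1, \<dots>, X\<^bsub>i-1\<^esub>\<close> can be
  \<open>M\<close>-measurable without being independent of \<open>X\<^sub>i\<close>.
\<close>

definition is_policy :: "nat \<Rightarrow> policy \<Rightarrow> bool" where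
  "is_policy n P \<longleftrightarrow>
     (\<forall>h. length h < n \<longrightarrow> P h \<in> {1..n}) \<and>
     (\<forall>i\<in>{1..n}. (\<lambda>x. bin_of P x i) \<in> measurable (\<Pi>\<^sub>M k\<in>{1..<i}. borel) (count_space UNIV))"

text \<open>
  Requirements on the run of a policy are imposed almost surely.
\<close>

definition feasible :: "'a measure \<Rightarrow> (nat \<Rightarrow> 'a \<Rightarrow> real) \<Rightarrow> nat \<Rightarrow> policy \<Rightarrow> bool" where
  "feasible M X n P \<longleftrightarrow> is_policy n P \<and>
     (AE \<omega> in M. let x = (\<lambda>k. X k \<omega>) in
        \<forall>i\<in>{1..n}. \<not> overflowed P x (i - 1) (bin_of P x i))"

definition risk_budgeted ::
  "'a measure \<Rightarrow> (nat \<Rightarrow> 'a \<Rightarrow> real) \<Rightarrow> nat \<Rightarrow> real \<Rightarrow> policy \<Rightarrow> bool" where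
  "risk_budgeted M X n r P \<longleftrightarrow> feasible M X n P \<and>
     (AE \<omega> in M. \<forall>j\<in>{1..n}. risk M X P (\<lambda>k. X k \<omega>) n j \<le> r)"

text \<open>The open bins into which Budgeted Greedy with parameter \<open>\<gamma>\<close> may pack item \<open>i\<close>.\<close>

definition greedy_bins ::
  "'a measure \<Rightarrow> (nat \<Rightarrow> 'a \<Rightarrow> real) \<Rightarrow> real \<Rightarrow> nat \<Rightarrow> real \<Rightarrow> policy \<Rightarrow> (nat \<Rightarrow> real) \<Rightarrow> nat \<Rightarrow> nat set"
  where
  "greedy_bins M X C n \<gamma> P x i =
     {j \<in> {1..n}. is_open P x (i - 1) j \<and> \<not> overflowed P x (i - 1) j \<and>
        risk M X P x (i - 1) j + overflow_prob M X i (usage P x (i - 1) j) \<le> \<gamma> / C}"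

text \<open>
  A predicate rather than a function, since ties and the labels of new bins are arbitrary.
\<close>

definition budgeted_greedy ::
  "'a measure \<Rightarrow> (nat \<Rightarrow> 'a \<Rightarrow> real) \<Rightarrow> real \<Rightarrow> nat \<Rightarrow> real \<Rightarrow> policy \<Rightarrow> bool" where
  "budgeted_greedy M X C n \<gamma> P \<longleftrightarrow> is_policy n P \<and>
     (AE \<omega> in M. let x = (\<lambda>k. X k \<omega>) in
        \<forall>i\<in>{1..n}. if greedy_bins M X C n \<gamma> P x i \<noteq> {}
                    then bin_of P x i \<in> greedy_bins M X C n \<gamma> P x i
                    else \<not> is_open P x (i - 1) (bin_of P x i))"

definition expected_opened :: "'a measure \<Rightarrow> (nat \<Rightarrow> 'a \<Rightarrow> real) \<Rightarrow> nat \<Rightarrow> policy \<Rightarrow> real" where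
  "expected_opened M X n P = (\<integral>\<omega>. real (num_opened P n (\<lambda>k. X k \<omega>)) \<partial>M)"

definition expected_overflowed :: "'a measure \<Rightarrow> (nat \<Rightarrow> 'a \<Rightarrow> real) \<Rightarrow> nat \<Rightarrow> policy \<Rightarrow> real" where
  "expected_overflowed M X n P = (\<integral>\<omega>. real (num_overflowed P n (\<lambda>k. X k \<omega>)) \<partial>M)"

definition cost :: "'a measure \<Rightarrow> (nat \<Rightarrow> 'a \<Rightarrow> real) \<Rightarrow> real \<Rightarrow> nat \<Rightarrow> policy \<Rightarrow> real" where
  "cost M X C n P = expected_opened M X n P + C * expected_overflowed M X n P"

definition cost_opt :: "'a measure \<Rightarrow> (nat \<Rightarrow> 'a \<Rightarrow> real) \<Rightarrow> real \<Rightarrow> nat \<Rightarrow> real" where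
  "cost_opt M X C n = (INF P\<in>{P. feasible M X n P}. cost M X C n P)"

end

theory Submission
  imports Defs
begin

text \<open>
  Write \<open>\<mu>\<close> for the common law of the sizes, \<open>\<rho> = \<gamma> / C\<close> for the budget and \<open>p(s) = \<mu>{y. y + s > 1}\<close>.
  Because the items are identically distributed, the number of items that a bin takes before it is
  broken or has no budget left for one more is a random lifetime whose law does not depend on when
  the bin is used or on the other bins. Budgeted Greedy has at most one bin that can still take an
  item, so it uses up independent lifetimes one after another, and its expected number of bins is a
  renewal quantity \<open>F\<^sub>n\<close>, the expected number of lifetimes needed to cover \<open>n\<close> items. A policy that keeps
  several bins going only distributes the items over the same kind of lifetimes: its number of bins
  cannot be smaller, and excess bins arise only when one is opened while another can still be used.

  To make this precise without a coupling, the lifetimes are encoded by generating functions: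
  \<open>fill_gf v\<close> is the law of the remaining lifetime of a bin in state \<open>v = (usage, risk)\<close>. Independent
  remaining lifetimes add up, so the generating functions multiply, and
  \<open>(fresh_gf * (\<Prod>j. fill_gf v\<^sub>j)) $ m\<close> is the expected number of new bins needed for \<open>m\<close> further items by
  a policy that first uses up the open bins \<open>v\<^sub>j\<close>. This is the potential. Packing an item into a bin
  that can take it keeps the expected potential, by the recursion for lifetimes; packing it into a
  new bin lowers the expected potential by at most 1, by the renewal equation, and by exactly 1 if no
  open bin could take the item (\<open>fresh_gf_step\<close>, \<open>potential_step\<close>). Adding this up over the rounds gives
  \<open>expected_restarts\<close>.

  The identity is proved for an arbitrary policy \<open>P\<close>, without any budget: along the run of \<open>P\<close>,
  virtual bins follow the bins of \<open>P\<close>, but are replaced by a new one whenever \<open>P\<close> uses a bin whose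
  virtual state is closed. The number of virtual bins is \<open>restarts\<close>, and always
  \<open>F\<^sub>n \<le> E[restarts]\<close>. This serves three times.

    \<^item> If \<open>P\<close> respects the budget, virtual and real bins agree almost surely, so \<open>F\<^sub>n \<le> E[N\<^sub>P]\<close>.

    \<^item> For Budgeted Greedy they agree as well and every loss vanishes, so \<open>E[N\<^bsub>ALG\<^esub>] = F\<^sub>n\<close>.

    \<^item> For any feasible \<open>P\<close>, each replacement of a virtual bin is paid for by a risk of more than \<open>\<rho>\<close>,
      in which an item can be counted at most twice: once in the bin where it is packed and once as
      the item that closed the preceding virtual bin. Hence \<open>restarts \<le> N\<^sub>P + (2/\<rho>) * total risk\<close>.

  Finally, the expected total risk is the expected number of overflows, since each item overflows its
  bin with conditional probability equal to the risk that it adds. For \<open>\<gamma> = \<surd>2\<close> this gives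
  \<open>E[N\<^bsub>ALG\<^esub>] \<le> E[N\<^sub>P] + \<surd>2 * C * E[O\<^sub>P] \<le> \<surd>2 * cost(P)\<close> and, if \<open>p(0) \<le> \<rho>\<close>,
  \<open>C * E[O\<^bsub>ALG\<^esub>] \<le> \<surd>2 * E[N\<^bsub>ALG\<^esub>]\<close>, so \<open>cost(ALG) \<le> (1 + \<surd>2) * \<surd>2 * cost(P)\<close>, and \<open>(1 + \<surd>2) * \<surd>2 = 2 + \<surd>2\<close>
  is less than \<open>3 + 2\<surd>2\<close>. If \<open>p(0) > \<rho>\<close>, then every item costs any policy at least the risk \<open>p(0)\<close>, and
  Budgeted Greedy does not incur more than that.
\<close>

unbundle no vec_syntax
unbundle fps_syntax

section \<open>Subprobability sequences\<close>

definition subprob_fps :: "real fps \<Rightarrow> bool" where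
  "subprob_fps A \<longleftrightarrow> (\<forall>k. 0 \<le> A $ k) \<and> (\<forall>m. (\<Sum>k\<le>m. A $ k) \<le> 1)"

lemma subprob_fps_coeff: "subprob_fps A \<Longrightarrow> 0 \<le> A $ k \<and> A $ k \<le> 1"
proof -
  assume A: "subprob_fps A"
  have "A $ k \<le> (\<Sum>k\<le>k. A $ k)"
    using A by (intro member_le_sum) (auto simp: subprob_fps_def)
  with A show ?thesis unfolding subprob_fps_def by (meson order_trans)
qed

lemma subprob_fps_1: "subprob_fps 1"
  by (auto simp: subprob_fps_def)

text \<open>
  Multiplication by \<open>1 / (1 - X)\<close> takes partial sums. Since it commutes with every other product, it
  turns statements about partial sums into statements about coefficients.
\<close>

lemma fps_ones_mult_nth: "(Abs_fps (\<lambda>_. 1) * A) $ m = (\<Sum>k\<le>m. (A :: real fps) $ k)"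
  by (subst mult.commute) (simp add: fps_mult_nth atLeast0AtMost)

lemma subprob_fps_mult:
  assumes A: "subprob_fps A" and B: "subprob_fps B"
  shows "subprob_fps (A * B)"
  unfolding subprob_fps_def
proof (intro conjI allI)
  show "0 \<le> (A * B) $ k" for k
    using A B by (auto simp: fps_mult_nth subprob_fps_def intro!: sum_nonneg)
  fix m
  have "(\<Sum>k\<le>m. (A * B) $ k) = (A * (Abs_fps (\<lambda>_. 1) * B)) $ m"
    by (simp add: fps_ones_mult_nth[symmetric] mult_ac)
  also have "\<dots> = (\<Sum>i=0..m. A $ i * (\<Sum>k\<le>m - i. B $ k))"
    by (subst fps_mult_nth) (simp only: fps_ones_mult_nth)
  also have "\<dots> \<le> (\<Sum>i=0..m. A $ i * 1)"
    using A B by (intro sum_mono mult_left_mono) (auto simp: subprob_fps_def)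
  also have "\<dots> \<le> 1"
    using A by (simp add: subprob_fps_def atLeast0AtMost)
  finally show "(\<Sum>k\<le>m. (A * B) $ k) \<le> 1" .
qed

lemma subprob_fps_prod: "(\<And>j. j \<in> J \<Longrightarrow> subprob_fps (A j)) \<Longrightarrow> subprob_fps (\<Prod>j\<in>J. A j)"
  by (induction J rule: infinite_finite_induct) (auto simp: subprob_fps_1 subprob_fps_mult)

section \<open>A single bin filled with i.i.d. sizes\<close>

text \<open>
  A state is a pair of usage and accumulated risk. The renewal theory of this section depends only
  on the law \<open>\<mu>\<close> of one item and on the budget \<open>\<rho>\<close>.
\<close>

locale size_law = prob_space \<mu> for \<mu> :: "real measure" +
  fixes \<rho> :: real
  assumes sets_law [measurable_cong]: "sets \<mu> = sets borel"
begin

definition tail :: "real \<Rightarrow> real" where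
  "tail s = measure \<mu> {y. y + s > 1}"

definition accepts :: "real \<times> real \<Rightarrow> bool" where
  "accepts v \<longleftrightarrow> fst v \<le> 1 \<and> snd v + tail (fst v) \<le> \<rho>"

text \<open>
  A closed bin is replaced by a new one. With this convention a single recursion covers both an open
  bin and the lifetime of a new bin.
\<close>

definition put :: "real \<times> real \<Rightarrow> real \<Rightarrow> real \<times> real" where
  "put v y = (if accepts v then (fst v + y, snd v + tail (fst v)) else (y, tail 0))"

text \<open>
  The probability that a bin in state \<open>v\<close> takes exactly \<open>t\<close> further items before it is closed.
  The mass of an infinite lifetime is not recorded, so these are subprobabilities.
\<close>

primrec fill_prob :: "nat \<Rightarrow> real \<times> real \<Rightarrow> real" where
  "fill_prob 0 v = (if accepts v then 0 else 1)"
| "fill_prob (Suc t) v = (if accepts v then \<integral>y. fill_prob t (put v y) \<partial>\<mu> else 0)"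

definition fill_gf :: "real \<times> real \<Rightarrow> real fps" where
  "fill_gf v = Abs_fps (\<lambda>t. fill_prob t v)"

lemma space_law [simp]: "space \<mu> = UNIV"
  using sets_eq_imp_space_eq[OF sets_law] by simp

lemma tail_nonneg: "0 \<le> tail s"
  and tail_le_1: "tail s \<le> 1"
  by (auto simp: tail_def)

lemma tail_mono: "s \<le> t \<Longrightarrow> tail s \<le> tail t"
  unfolding tail_def by (intro finite_measure_mono) auto

lemma measurable_tail [measurable]: "tail \<in> borel_measurable borel"
  by (intro borel_measurable_mono monoI tail_mono)

lemma measurable_accepts [measurable]: "Measurable.pred (borel \<Otimes>\<^sub>M borel) accepts"
  unfolding accepts_def by measurable

lemma measurable_put [measurable]:
  "case_prod put \<in> (borel \<Otimes>\<^sub>M borel) \<Otimes>\<^sub>M borel \<rightarrow>\<^sub>M borel \<Otimes>\<^sub>M borel"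
  unfolding put_def case_prod_unfold by measurable

lemma measurable_put_size: "put v \<in> borel \<rightarrow>\<^sub>M borel \<Otimes>\<^sub>M borel"
  using measurable_compose[OF measurable_Pair1'[of v "borel \<Otimes>\<^sub>M borel" borel] measurable_put]
  by (simp add: space_pair_measure)

lemma measurable_fill_prob [measurable]: "fill_prob t \<in> borel_measurable (borel \<Otimes>\<^sub>M borel)"
proof (induction t)
  case 0
  show ?case by simp
next
  case (Suc t)
  note [measurable] = this
  have [measurable]: "(\<lambda>v. \<integral>y. fill_prob t (put v y) \<partial>\<mu>) \<in> borel_measurable (borel \<Otimes>\<^sub>M borel)"
    by (rule borel_measurable_lebesgue_integral) measurable
  show ?case by simp
qed

lemma measurable_fill_prob_put: "(\<lambda>y. fill_prob t (put v y)) \<in> borel_measurable \<mu>"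
  using measurable_compose[OF measurable_put_size measurable_fill_prob]
  by (simp add: measurable_cong_sets[OF sets_law refl])

lemma fill_prob_bounds: "0 \<le> fill_prob t v \<and> fill_prob t v \<le> 1"
proof (induction t arbitrary: v)
  case (Suc t)
  have "integrable \<mu> (\<lambda>y. fill_prob t (put v y))"
    using Suc.IH by (intro integrable_const_bound[where B=1] measurable_fill_prob_put) auto
  then have "(\<integral>y. fill_prob t (put v y) \<partial>\<mu>) \<le> 1"
    by (rule integral_le_const) (simp add: Suc.IH)
  moreover have "0 \<le> (\<integral>y. fill_prob t (put v y) \<partial>\<mu>)"
    by (simp add: Suc.IH)
  ultimately show ?case by simp
qed simp

lemma integrable_fill_prob: "integrable \<mu> (\<lambda>y. fill_prob t (put v y))"
  using fill_prob_bounds by (intro integrable_const_bound[where B=1] measurable_fill_prob_put) auto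

lemma sum_fill_prob_le_1: "(\<Sum>t\<le>m. fill_prob t v) \<le> 1"
proof (induction m arbitrary: v)
  case (Suc m)
  show ?case
  proof (cases "accepts v")
    case True
    have "(\<Sum>t\<le>Suc m. fill_prob t v) = (\<Sum>t\<le>m. \<integral>y. fill_prob t (put v y) \<partial>\<mu>)"
      using True by (simp add: sum.atMost_Suc_shift del: sum.atMost_Suc)
    also have "\<dots> = (\<integral>y. (\<Sum>t\<le>m. fill_prob t (put v y)) \<partial>\<mu>)"
      by (simp add: integrable_fill_prob)
    also have "\<dots> \<le> 1"
      using Suc.IH by (intro integral_le_const) (auto simp: integrable_fill_prob)
    finally show ?thesis .
  next
    case False
    then show ?thesis by (simp add: sum.atMost_Suc_shift del: sum.atMost_Suc)
  qed
qed auto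

lemma fill_gf_nth: "fill_gf v $ k = fill_prob k v"
  by (simp add: fill_gf_def)

lemma subprob_fill_gf: "subprob_fps (fill_gf v)"
  by (auto simp: subprob_fps_def fill_gf_def fill_prob_bounds sum_fill_prob_le_1)

lemma fill_gf_closed: "\<not> accepts v \<Longrightarrow> fill_gf v = 1"
proof (rule fps_ext)
  show "\<not> accepts v \<Longrightarrow> fill_gf v $ k = 1 $ k" for k
    by (cases k) (auto simp: fill_gf_def)
qed

text \<open>
  \<open>fill_after v\<close> is the law of the remaining lifetime after one more item; for closed \<open>v\<close>, that of the
  replacement bin. \<open>lifetime_gf\<close> counts in addition the item with which a new bin is opened, which is
  packed even if \<open>tail 0 > \<rho>\<close>.
\<close>

definition fill_after :: "real \<times> real \<Rightarrow> real fps" where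
  "fill_after v = Abs_fps (\<lambda>t. \<integral>y. fill_prob t (put v y) \<partial>\<mu>)"

definition lifetime_gf :: "real fps" where
  "lifetime_gf = fps_X * Abs_fps (\<lambda>t. \<integral>y. fill_prob t (y, tail 0) \<partial>\<mu>)"

text \<open>
  The coefficients \<open>F\<^sub>k\<close> are the expected numbers of new bins needed for \<open>k\<close> items. Conditioning on the
  lifetime \<open>T\<close> of the first bin gives \<open>F\<^sub>k = 1 + E[F\<^bsub>k - T\<^esub>]\<close> for \<open>k \<ge> 1\<close>, where \<open>F\<close> vanishes for arguments
  \<open>\<le> 0\<close>; as an equation of power series this is \<open>F = X / (1 - X) + lifetime_gf * F\<close>.
\<close>

definition fresh_gf :: "real fps" where
  "fresh_gf = (fps_X * Abs_fps (\<lambda>_. 1)) * inverse (1 - lifetime_gf)"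

lemma fresh_gf_renewal: "fresh_gf = fps_X * Abs_fps (\<lambda>_. 1) + lifetime_gf * fresh_gf"
proof -
  have "(1 - lifetime_gf) $ 0 \<noteq> 0"
    by (simp add: lifetime_gf_def)
  then have "inverse (1 - lifetime_gf) * (1 - lifetime_gf) = 1"
    by (rule inverse_mult_eq_1)
  then have "fresh_gf * (1 - lifetime_gf) = fps_X * Abs_fps (\<lambda>_. 1)"
    by (simp add: fresh_gf_def mult.assoc)
  then show ?thesis by (simp add: algebra_simps)
qed

lemma fresh_gf_0 [simp]: "fresh_gf $ 0 = 0"
  by (simp add: fresh_gf_def)

lemma X_mult_fill_after:
  "fps_X * fill_after v = (if accepts v then fill_gf v else lifetime_gf)"
proof (rule fps_ext)
  show "(fps_X * fill_after v) $ n = (if accepts v then fill_gf v else lifetime_gf) $ n" for n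
    by (cases n) (auto simp: fill_after_def fill_gf_def lifetime_gf_def put_def)
qed

lemma integral_mult_fill_gf:
  "(\<integral>y. (A * fill_gf (put v y)) $ m \<partial>\<mu>) = (A * fill_after v) $ m"
  by (simp add: fps_mult_nth fill_gf_def fill_after_def integrable_fill_prob)

text \<open>
  The change in one round of the expected number of new bins still needed.
  \<open>R\<close> is the contribution of the bins that are not used in this round and \<open>v\<close> the state of the used bin.
  If \<open>v\<close> is open, the recursion for \<open>fill_gf\<close> shifts the series by one and nothing is lost. If \<open>v\<close> is
  closed, a new bin is started, and the renewal equation yields the drop
  \<open>(X / (1 - X) * R) $ Suc m\<close>, which is the probability that the open bins would have been exhausted
  before covering the remaining items.
\<close>

lemma fresh_gf_step:
  assumes R: "\<not> accepts v \<Longrightarrow> S = R" "accepts v \<Longrightarrow> S = R * fill_gf v"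
  shows "(\<integral>y. (fresh_gf * (R * fill_gf (put v y))) $ m \<partial>\<mu>) =
     (fresh_gf * S) $ Suc m - (if accepts v then 0 else (\<Sum>k\<le>m. S $ k))"
proof -
  have "(\<integral>y. (fresh_gf * (R * fill_gf (put v y))) $ m \<partial>\<mu>) = (fresh_gf * R * fill_after v) $ m"
    using integral_mult_fill_gf[of "fresh_gf * R"] by (simp add: mult.assoc)
  also have "\<dots> = (fps_X * (fresh_gf * R * fill_after v)) $ Suc m"
    by simp
  also have "\<dots> = (fresh_gf * R * (if accepts v then fill_gf v else lifetime_gf)) $ Suc m"
    by (simp only: X_mult_fill_after[symmetric] mult_ac)
  also have "\<dots> = (fresh_gf * S) $ Suc m - (if accepts v then 0 else (\<Sum>k\<le>m. S $ k))"
  proof (cases "accepts v")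
    case False
    have "fresh_gf * R = fps_X * (Abs_fps (\<lambda>_. 1) * R) + fresh_gf * R * lifetime_gf"
      by (subst fresh_gf_renewal) (simp only: algebra_simps)
    then have "(fresh_gf * R) $ Suc m =
        (fps_X * (Abs_fps (\<lambda>_. 1) * R)) $ Suc m + (fresh_gf * R * lifetime_gf) $ Suc m"
      by (metis fps_add_nth)
    also have "(fps_X * (Abs_fps (\<lambda>_. 1) * R)) $ Suc m = (\<Sum>k\<le>m. R $ k)"
      by (simp add: fps_ones_mult_nth)
    finally show ?thesis using False R by simp
  qed (use R in \<open>simp add: mult.assoc\<close>)
  finally show ?thesis .
qed

section \<open>Virtual bins\<close>

text \<open>
  The virtual bins that follow the bins of a policy. A bin that has not been opened carries the state
  \<open>(2, 0)\<close>, which is closed because its usage exceeds 1; so opening a bin and replacing a closed one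
  are the same operation.
\<close>

primrec vstate :: "policy \<Rightarrow> (nat \<Rightarrow> real) \<Rightarrow> nat \<Rightarrow> nat \<Rightarrow> real \<times> real" where
  "vstate P x 0 = (\<lambda>j. (2, 0))"
| "vstate P x (Suc i) = (let j = bin_of P x (Suc i)
     in (vstate P x i)(j := put (vstate P x i j) (x (Suc i))))"

primrec restarts :: "policy \<Rightarrow> (nat \<Rightarrow> real) \<Rightarrow> nat \<Rightarrow> nat" where
  "restarts P x 0 = 0"
| "restarts P x (Suc i) =
     restarts P x i + (if accepts (vstate P x i (bin_of P x (Suc i))) then 0 else 1)"

end

section \<open>Runs as measurable functions of the sizes\<close>

text \<open>
  Everything that happens in a run is a function of the sequence of sizes. All such functions are
  considered on one space of infinite sequences, and the congruence rules record on which coordinates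
  they depend.
\<close>

abbreviation path_space :: "(nat \<Rightarrow> real) measure" where
  "path_space \<equiv> \<Pi>\<^sub>M k\<in>UNIV. borel"

lemma hist_cong: "(\<And>k. k \<in> {1..i} \<Longrightarrow> x k = y k) \<Longrightarrow> hist P x i = hist P y i"
  by (induction i) auto

lemma bin_of_cong: "(\<And>k. k \<in> {1..<i} \<Longrightarrow> x k = y k) \<Longrightarrow> bin_of P x i = bin_of P y i"
  unfolding bin_of_def by (intro arg_cong[where f=P] hist_cong) auto

lemma length_hist [simp]: "length (hist P x i) = i"
  by (induction i) auto

lemma bin_of_range: "is_policy n P \<Longrightarrow> i \<in> {1..n} \<Longrightarrow> bin_of P x i \<in> {1..n}"
  using length_hist[of P x "i - 1"]
  unfolding is_policy_def bin_of_def by (metis One_nat_def Suc_le_eq Suc_pred' atLeastAtMost_iff)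

lemma items_in_cong: "(\<And>k. k \<in> {1..i} \<Longrightarrow> x k = y k) \<Longrightarrow> items_in P x i j = items_in P y i j"
  unfolding items_in_def using bin_of_cong[of _ x y P] by fastforce

lemma usage_cong: "(\<And>k. k \<in> {1..i} \<Longrightarrow> x k = y k) \<Longrightarrow> usage P x i j = usage P y i j"
  unfolding usage_def by (intro sum.cong items_in_cong) (auto simp: items_in_def)

lemma is_open_cong: "(\<And>k. k \<in> {1..i} \<Longrightarrow> x k = y k) \<Longrightarrow> is_open P x i j = is_open P y i j"
  unfolding is_open_def using items_in_cong[of i x y P j] by auto

lemma measurable_bin_of:
  assumes "is_policy n P" "i \<in> {1..n}"
  shows "(\<lambda>x. bin_of P x i) \<in> path_space \<rightarrow>\<^sub>M count_space UNIV"
proof -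
  have "(\<lambda>x. restrict x {1..<i}) \<in> path_space \<rightarrow>\<^sub>M (\<Pi>\<^sub>M k\<in>{1..<i}. borel)"
    by (rule measurable_restrict_subset) simp
  moreover have "(\<lambda>x. bin_of P x i) \<in> (\<Pi>\<^sub>M k\<in>{1..<i}. borel) \<rightarrow>\<^sub>M count_space UNIV"
    using assms unfolding is_policy_def by blast
  ultimately have "(\<lambda>x. bin_of P (restrict x {1..<i}) i) \<in> path_space \<rightarrow>\<^sub>M count_space UNIV"
    by (rule measurable_compose)
  moreover have "bin_of P (restrict x {1..<i}) i = bin_of P x i" for x
    by (intro bin_of_cong) auto
  ultimately show ?thesis by simp
qed

lemma usage_eq_sum: "usage P x i j = (\<Sum>k\<in>{1..i}. if bin_of P x k = j then x k else 0)"
  unfolding usage_def items_in_def by (rule sum.inter_filter) simp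

lemma is_open_iff: "is_open P x i j \<longleftrightarrow> (\<exists>k\<in>{1..i}. bin_of P x k = j)"
  by (auto simp: is_open_def items_in_def)

lemma items_in_Suc:
  "items_in P x (Suc i) j = (if bin_of P x (Suc i) = j then insert (Suc i) (items_in P x i j)
     else items_in P x i j)"
  by (auto simp: items_in_def le_Suc_eq)

lemma finite_items_in [simp]: "finite (items_in P x i j)"
  by (simp add: items_in_def)

lemma not_in_items_in [simp]: "Suc i \<notin> items_in P x i j"
  by (simp add: items_in_def)

lemma usage_Suc:
  "usage P x (Suc i) j = usage P x i j + (if bin_of P x (Suc i) = j then x (Suc i) else 0)"
  by (simp add: usage_def items_in_Suc)

lemma is_open_0 [simp]: "\<not> is_open P x 0 j"
  by (simp add: is_open_def items_in_def)

lemma is_open_Suc: "is_open P x (Suc i) j \<longleftrightarrow> bin_of P x (Suc i) = j \<or> is_open P x i j"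
  by (simp add: is_open_def items_in_Suc)

lemma usage_not_open: "\<not> is_open P x i j \<Longrightarrow> usage P x i j = 0"
  by (simp add: is_open_def usage_def)

lemma usage_nonneg: "(\<And>k. 0 \<le> x k) \<Longrightarrow> 0 \<le> usage P x i j"
  by (simp add: usage_def sum_nonneg)

lemma measurable_usage:
  assumes "is_policy n P" "i \<le> n"
  shows "(\<lambda>x. usage P x i j) \<in> borel_measurable path_space"
proof -
  have "(\<lambda>x. if bin_of P x k = j then x k else 0) \<in> borel_measurable path_space"
    if "k \<in> {1..i}" for k
  proof -
    have [measurable]: "(\<lambda>x. bin_of P x k) \<in> path_space \<rightarrow>\<^sub>M count_space UNIV"
      using assms that by (intro measurable_bin_of[of n]) auto
    show ?thesis by measurable
  qed
  then show ?thesis unfolding usage_eq_sum by (rule borel_measurable_sum)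
qed

lemma measurable_is_open:
  assumes "is_policy n P" "i \<le> n"
  shows "Measurable.pred path_space (\<lambda>x. is_open P x i j)"
proof -
  have "Measurable.pred path_space (\<lambda>x. bin_of P x k = j)" if "k \<in> {1..i}" for k
  proof -
    have [measurable]: "(\<lambda>x. bin_of P x k) \<in> path_space \<rightarrow>\<^sub>M count_space UNIV"
      using assms that by (intro measurable_bin_of[of n]) auto
    show ?thesis by measurable
  qed
  then show ?thesis unfolding is_open_iff by (intro pred_intros_finite) auto
qed

lemma num_opened_eq_sum: "num_opened P n x = (\<Sum>j\<in>{1..n}. if is_open P x n j then 1 else 0)"
  unfolding num_opened_def by (simp add: sum.inter_filter[symmetric])

lemma num_overflowed_eq_sum:
  "num_overflowed P n x = (\<Sum>j\<in>{1..n}. if overflowed P x n j then 1 else 0)"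
  unfolding num_overflowed_def by (simp add: sum.inter_filter[symmetric])

lemma num_opened_Suc:
  assumes "bin_of P x (Suc i) \<in> {1..n}"
  shows "card {j \<in> {1..n}. is_open P x (Suc i) j} = card {j \<in> {1..n}. is_open P x i j}
     + (if is_open P x i (bin_of P x (Suc i)) then 0 else 1)"
proof -
  have "{j \<in> {1..n}. is_open P x (Suc i) j} =
      insert (bin_of P x (Suc i)) {j \<in> {1..n}. is_open P x i j}"
    using assms by (auto simp: is_open_Suc)
  then show ?thesis using assms by (simp add: card_insert_if)
qed

lemma measurable_num_opened:
  assumes "is_policy n P"
  shows "(\<lambda>x. real (num_opened P n x)) \<in> borel_measurable path_space"
proof -
  note measurable_is_open[OF assms order_refl, measurable]
  show ?thesis unfolding num_opened_eq_sum by measurable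
qed

lemma measurable_num_overflowed:
  assumes "is_policy n P"
  shows "(\<lambda>x. real (num_overflowed P n x)) \<in> borel_measurable path_space"
proof -
  note measurable_usage[OF assms order_refl, measurable]
  show ?thesis unfolding num_overflowed_eq_sum overflowed_def by measurable
qed

section \<open>The potential\<close>

context size_law
begin

lemma vstate_cong: "(\<And>k. k \<in> {1..i} \<Longrightarrow> x k = y k) \<Longrightarrow> vstate P x i = vstate P y i"
proof (induction i)
  case (Suc i)
  moreover have "bin_of P x (Suc i) = bin_of P y (Suc i)"
    using Suc.prems by (intro bin_of_cong) auto
  moreover have "x (Suc i) = y (Suc i)" using Suc.prems by auto
  ultimately show ?case by (simp add: Let_def)
qed simp

lemma measurable_vstate:
  assumes "is_policy n P" "i \<le> n"
  shows "(\<lambda>x. vstate P x i j) \<in> path_space \<rightarrow>\<^sub>M borel \<Otimes>\<^sub>M borel"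
  using assms(2)
proof (induction i arbitrary: j)
  case (Suc i)
  then have [measurable]: "(\<lambda>x. vstate P x i k) \<in> path_space \<rightarrow>\<^sub>M borel \<Otimes>\<^sub>M borel" for k
    by auto
  have [measurable]: "(\<lambda>x. bin_of P x (Suc i)) \<in> path_space \<rightarrow>\<^sub>M count_space UNIV"
    using assms Suc.prems by (intro measurable_bin_of[of n]) auto
  have "(\<lambda>x. if bin_of P x (Suc i) = j then put (vstate P x i j) (x (Suc i)) else vstate P x i j)
      \<in> path_space \<rightarrow>\<^sub>M borel \<Otimes>\<^sub>M borel"
    by measurable
  also have "(\<lambda>x. if bin_of P x (Suc i) = j then put (vstate P x i j) (x (Suc i)) else vstate P x i j)
      = (\<lambda>x. vstate P x (Suc i) j)"
    by (auto simp: Let_def)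
  finally show ?case .
qed simp

lemma measurable_accepts_vstate:
  assumes "is_policy n P" "i < n"
  shows "Measurable.pred path_space (\<lambda>x. accepts (vstate P x i (bin_of P x (Suc i))))"
proof -
  have [measurable]: "(\<lambda>x. vstate P x i k) \<in> path_space \<rightarrow>\<^sub>M borel \<Otimes>\<^sub>M borel" for k
    using assms by (intro measurable_vstate[of n]) auto
  have [measurable]: "(\<lambda>x. bin_of P x (Suc i)) \<in> path_space \<rightarrow>\<^sub>M count_space UNIV"
    using assms by (intro measurable_bin_of[of n]) auto
  have "Measurable.pred path_space
      (\<lambda>x. \<exists>j\<in>{1..n}. bin_of P x (Suc i) = j \<and> accepts (vstate P x i j))"
    by measurable
  moreover have "(\<exists>j\<in>{1..n}. bin_of P x (Suc i) = j \<and> accepts (vstate P x i j)) \<longleftrightarrow>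
      accepts (vstate P x i (bin_of P x (Suc i)))" for x
    using bin_of_range[of n P "Suc i" x] assms by auto
  ultimately show ?thesis by simp
qed

lemma measurable_restarts:
  assumes "is_policy n P" "i \<le> n"
  shows "(\<lambda>x. real (restarts P x i)) \<in> borel_measurable path_space"
  using assms(2)
proof (induction i)
  case (Suc i)
  note measurable_accepts_vstate[OF assms(1), of i, measurable]
  show ?case using Suc by simp
qed simp

definition open_gf :: "policy \<Rightarrow> nat \<Rightarrow> (nat \<Rightarrow> real) \<Rightarrow> nat \<Rightarrow> real fps" where
  "open_gf P n x i = (\<Prod>j\<in>{1..n}. fill_gf (vstate P x i j))"

lemma subprob_open_gf: "subprob_fps (open_gf P n x i)"
  unfolding open_gf_def by (intro subprob_fps_prod subprob_fill_gf)

lemma measurable_open_gf: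
  assumes "is_policy n P" "i \<le> n"
  shows "(\<lambda>x. open_gf P n x i $ k) \<in> borel_measurable path_space"
proof -
  have [measurable]: "(\<lambda>x. vstate P x i j) \<in> path_space \<rightarrow>\<^sub>M borel \<Otimes>\<^sub>M borel" for j
    using assms by (intro measurable_vstate[of n]) auto
  have "(\<lambda>x. (\<Prod>j\<in>J. fill_gf (vstate P x i j)) $ k) \<in> borel_measurable path_space" for J
  proof (induction J arbitrary: k rule: infinite_finite_induct)
    case (insert j J)
    note [measurable] = insert.IH
    show ?case using insert.hyps by (simp add: fps_mult_nth fill_gf_nth)
  qed simp_all
  then show ?thesis by (simp add: open_gf_def)
qed

text \<open>
  The expected loss when round \<open>Suc i\<close> starts a new virtual bin: the probability that the remaining
  lifetimes of the bins at hand sum up to at least the \<open>n - i\<close> items that are still to be packed.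
\<close>

definition waste :: "policy \<Rightarrow> nat \<Rightarrow> (nat \<Rightarrow> real) \<Rightarrow> nat \<Rightarrow> real" where
  "waste P n x i = (if accepts (vstate P x i (bin_of P x (Suc i))) then 0
     else 1 - (\<Sum>k<n - i. open_gf P n x i $ k))"

lemma waste_nonneg: "i < n \<Longrightarrow> 0 \<le> waste P n x i"
  using subprob_open_gf[of P n x i]
  by (cases "n - i") (auto simp: waste_def subprob_fps_def lessThan_Suc_atMost simp del: sum.lessThan_Suc)

text \<open>
  The expected number of further bins needed after round \<open>i\<close> if the bins at hand are used up first.
\<close>

definition potential :: "policy \<Rightarrow> nat \<Rightarrow> (nat \<Rightarrow> real) \<Rightarrow> nat \<Rightarrow> real" where
  "potential P n x i = (fresh_gf * open_gf P n x i) $ (n - i)"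

lemma potential_step:
  assumes P: "is_policy n P" and i: "i < n"
  shows "(\<integral>y. potential P n (x(Suc i := y)) (Suc i) \<partial>\<mu>) = potential P n x i + waste P n x i
     - (if accepts (vstate P x i (bin_of P x (Suc i))) then 0 else 1)"
proof -
  define b where "b = bin_of P x (Suc i)"
  define R where "R = (\<Prod>j\<in>{1..n} - {b}. fill_gf (vstate P x i j))"
  have b: "b \<in> {1..n}" using bin_of_range[OF P] i by (auto simp: b_def)
  have S: "open_gf P n x i = R * fill_gf (vstate P x i b)"
    unfolding open_gf_def R_def using b by (subst prod.remove[of _ b]) (auto simp: mult.commute)
  have S': "open_gf P n (x(Suc i := y)) (Suc i) = R * fill_gf (put (vstate P x i b) y)" for y
  proof -
    have "bin_of P (x(Suc i := y)) (Suc i) = b"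
      unfolding b_def by (intro bin_of_cong) auto
    moreover have "vstate P (x(Suc i := y)) i = vstate P x i"
      by (intro vstate_cong) auto
    ultimately have "vstate P (x(Suc i := y)) (Suc i) = (vstate P x i)(b := put (vstate P x i b) y)"
      by (simp add: Let_def)
    then have "open_gf P n (x(Suc i := y)) (Suc i) =
        (\<Prod>j\<in>{1..n}. fill_gf (((vstate P x i)(b := put (vstate P x i b) y)) j))"
      by (simp add: open_gf_def)
    also have "\<dots> = R * fill_gf (put (vstate P x i b) y)"
      unfolding R_def using b by (subst prod.remove[of _ b]) (auto simp: mult.commute intro!: prod.cong)
    finally show ?thesis .
  qed
  have n: "n - i = Suc (n - Suc i)" using i by simp
  have "(\<integral>y. potential P n (x(Suc i := y)) (Suc i) \<partial>\<mu>) = (fresh_gf * open_gf P n x i) $ Suc (n - Suc i)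
      - (if accepts (vstate P x i b) then 0 else (\<Sum>k\<le>n - Suc i. open_gf P n x i $ k))"
    unfolding potential_def S'
    by (rule fresh_gf_step) (auto simp: S fill_gf_closed)
  then show ?thesis
    by (auto simp: potential_def waste_def b_def[symmetric] n lessThan_Suc_atMost simp del: sum.lessThan_Suc)
qed

lemma potential_bound: "\<bar>potential P n x i\<bar> \<le> (\<Sum>k\<in>{0..n}. \<bar>fresh_gf $ k\<bar>)"
proof -
  have "\<bar>potential P n x i\<bar> \<le> (\<Sum>k\<in>{0..n - i}. \<bar>fresh_gf $ k * open_gf P n x i $ (n - i - k)\<bar>)"
    unfolding potential_def fps_mult_nth by (rule sum_abs)
  also have "\<dots> \<le> (\<Sum>k\<in>{0..n - i}. \<bar>fresh_gf $ k\<bar> * 1)"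
    unfolding abs_mult using subprob_fps_coeff[OF subprob_open_gf]
    by (intro sum_mono mult_left_mono) auto
  also have "\<dots> \<le> (\<Sum>k\<in>{0..n}. \<bar>fresh_gf $ k\<bar>)"
    by simp (intro sum_mono2, auto)
  finally show ?thesis .
qed

lemma measurable_potential:
  assumes "is_policy n P" "i \<le> n"
  shows "(\<lambda>x. potential P n x i) \<in> borel_measurable path_space"
proof -
  note measurable_open_gf[OF assms, measurable]
  show ?thesis unfolding potential_def fps_mult_nth by measurable
qed

lemma measurable_waste:
  assumes "is_policy n P" "i < n"
  shows "(\<lambda>x. waste P n x i) \<in> borel_measurable path_space"
proof -
  note measurable_open_gf[OF assms(1) less_imp_le[OF assms(2)], measurable]
    measurable_accepts_vstate[OF assms, measurable]
  show ?thesis unfolding waste_def by measurable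
qed

end

section \<open>Comparison of virtual and real bins along a path\<close>

context size_law
begin

definition bin_risk :: "policy \<Rightarrow> (nat \<Rightarrow> real) \<Rightarrow> nat \<Rightarrow> nat \<Rightarrow> real" where
  "bin_risk P x i j = (\<Sum>k\<in>items_in P x i j. tail (usage P x (k - 1) j))"

lemma bin_risk_0 [simp]: "bin_risk P x 0 j = 0"
  by (simp add: bin_risk_def items_in_def)

lemma bin_risk_Suc:
  "bin_risk P x (Suc i) j = bin_risk P x i j
     + (if bin_of P x (Suc i) = j then tail (usage P x i j) else 0)"
  by (simp add: bin_risk_def items_in_Suc)

lemma bin_risk_not_open: "\<not> is_open P x i j \<Longrightarrow> bin_risk P x i j = 0"
  by (simp add: is_open_def bin_risk_def)

lemma bin_risk_mono: "i \<le> k \<Longrightarrow> bin_risk P x i j \<le> bin_risk P x k j"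
  unfolding bin_risk_def by (intro sum_mono2) (auto simp: items_in_def tail_nonneg)

lemma sum_bin_risk:
  assumes "is_policy n P" "i \<le> n"
  shows "(\<Sum>j\<in>{1..n}. bin_risk P x i j) = (\<Sum>k<i. tail (usage P x k (bin_of P x (Suc k))))"
  using assms(2)
proof (induction i)
  case (Suc i)
  then show ?case
    using bin_of_range[OF assms(1), of "Suc i" x] by (simp add: bin_risk_Suc sum.distrib)
qed simp

lemma not_accepts_initial: "\<not> accepts (2, 0)"
  by (simp add: accepts_def)

text \<open>
  As long as the policy only uses open bins that can take an item within the budget, no virtual bin
  is ever replaced, and the virtual states are the real ones.
\<close>

lemma vstate_faithful:
  assumes acc: "\<And>i. i < n \<Longrightarrow> is_open P x i (bin_of P x (Suc i)) \<Longrightarrow>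
      accepts (usage P x i (bin_of P x (Suc i)), bin_risk P x i (bin_of P x (Suc i)))"
    and "i \<le> n"
  shows "vstate P x i j = (if is_open P x i j then (usage P x i j, bin_risk P x i j) else (2, 0))"
  using \<open>i \<le> n\<close>
proof (induction i arbitrary: j)
  case (Suc i)
  then have IH: "vstate P x i j =
      (if is_open P x i j then (usage P x i j, bin_risk P x i j) else (2, 0))" for j
    by simp
  show ?case
  proof (cases "bin_of P x (Suc i) = j")
    case True
    show ?thesis
    proof (cases "is_open P x i j")
      case opened: True
      with acc[of i] True Suc.prems have "accepts (usage P x i j, bin_risk P x i j)" by simp
      with opened True show ?thesis
        by (simp add: Let_def IH put_def is_open_Suc usage_Suc bin_risk_Suc)
    next
      case False
      with True show ?thesis
        by (simp add: Let_def IH put_def is_open_Suc usage_Suc bin_risk_Suc not_accepts_initial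
            usage_not_open bin_risk_not_open)
    qed
  next
    case False
    then have "vstate P x (Suc i) j = vstate P x i j" by (simp add: Let_def)
    with False show ?thesis
      by (simp add: IH is_open_Suc usage_Suc bin_risk_Suc)
  qed
qed simp

lemma restarts_faithful:
  assumes P: "is_policy n P"
    and acc: "\<And>i. i < n \<Longrightarrow> is_open P x i (bin_of P x (Suc i)) \<Longrightarrow>
      accepts (usage P x i (bin_of P x (Suc i)), bin_risk P x i (bin_of P x (Suc i)))"
  shows "restarts P x n = num_opened P n x"
proof -
  have "restarts P x i = card {j \<in> {1..n}. is_open P x i j}" if "i \<le> n" for i
    using that
  proof (induction i)
    case (Suc i)
    then have i: "i < n" by simp
    have "accepts (vstate P x i (bin_of P x (Suc i))) \<longleftrightarrow> is_open P x i (bin_of P x (Suc i))"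
      using acc[OF i] i
      by (subst vstate_faithful[where n = n, OF acc]) (auto simp: not_accepts_initial)
    then show ?case
      using Suc num_opened_Suc[OF bin_of_range[OF P, of "Suc i" x]] by simp
  qed simp
  then show ?thesis by (simp add: num_opened_def)
qed

text \<open>
  The charging argument for arbitrary feasible policies. It is an induction over the rounds for the
  stronger inequality that has the sum of the current virtual risks added on the left. When a closed
  virtual bin \<open>v\<close> is replaced, \<open>snd v + tail (fst v) > \<rho>\<close>; the risk \<open>snd v\<close> leaves the left side, and
  both \<open>tail (fst v)\<close> and the risk \<open>tail 0\<close> of the replacement are at most the risk that the item adds to
  the real bin, because the virtual usage is never larger than the real one. This is the factor 2.
\<close>

lemma restarts_le_opened_plus_risk:
  assumes P: "is_policy n P" and x: "\<And>k. 0 \<le> x k"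
    and feas: "\<And>i. i < n \<Longrightarrow> usage P x i (bin_of P x (Suc i)) \<le> 1"
  shows "\<rho> * (real (restarts P x n) - real (num_opened P n x)) \<le> 2 * (\<Sum>j\<in>{1..n}. bin_risk P x n j)"
proof -
  let ?o = "\<lambda>i. real (card {j \<in> {1..n}. is_open P x i j})"
  have inv: "(\<forall>j. 0 \<le> snd (vstate P x i j) \<and>
        (if is_open P x i j then fst (vstate P x i j) \<le> usage P x i j else vstate P x i j = (2, 0))) \<and>
      \<rho> * (real (restarts P x i) - ?o i) + (\<Sum>j\<in>{1..n}. snd (vstate P x i j))
        \<le> 2 * (\<Sum>j\<in>{1..n}. bin_risk P x i j)" if "i \<le> n" for i
    using that
  proof (induction i)
    case (Suc i)
    define b where "b = bin_of P x (Suc i)"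
    define v where "v = vstate P x i b"
    have b: "b \<in> {1..n}" using bin_of_range[OF P] Suc.prems by (simp add: b_def)
    have st: "vstate P x (Suc i) = (vstate P x i)(b := put v (x (Suc i)))"
      by (simp add: Let_def b_def v_def)
    have IH1: "0 \<le> snd (vstate P x i j)"
      "is_open P x i j \<Longrightarrow> fst (vstate P x i j) \<le> usage P x i j"
      "\<not> is_open P x i j \<Longrightarrow> vstate P x i j = (2, 0)" for j
      using Suc by (auto split: if_splits)
    have IH2: "\<rho> * (real (restarts P x i) - ?o i) + (\<Sum>j\<in>{1..n}. snd (vstate P x i j))
        \<le> 2 * (\<Sum>j\<in>{1..n}. bin_risk P x i j)"
      using Suc by simp
    have u: "0 \<le> usage P x i b" "usage P x i b \<le> 1"
      using usage_nonneg[OF x] feas[of i] Suc.prems by (auto simp: b_def)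
    have sum_snd: "(\<Sum>j\<in>{1..n}. snd (vstate P x (Suc i) j))
        = (\<Sum>j\<in>{1..n}. snd (vstate P x i j)) + (snd (put v (x (Suc i))) - snd v)"
      using b by (simp add: st sum.remove[of _ b] v_def del: vstate.simps)
    have sum_risk: "(\<Sum>j\<in>{1..n}. bin_risk P x (Suc i) j)
        = (\<Sum>j\<in>{1..n}. bin_risk P x i j) + tail (usage P x i b)"
      using b by (simp add: bin_risk_Suc sum.distrib b_def)
    have opn: "?o (Suc i) = ?o i + (if is_open P x i b then 0 else 1)"
      using num_opened_Suc[of P x i n] b by (simp add: b_def)
    have rst: "real (restarts P x (Suc i)) = real (restarts P x i) + (if accepts v then 0 else 1)"
      by (simp add: b_def v_def)
    have t0: "tail 0 \<le> tail (usage P x i b)" using u by (intro tail_mono)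
    have states: "0 \<le> snd (vstate P x (Suc i) j) \<and>
        (if is_open P x (Suc i) j then fst (vstate P x (Suc i) j) \<le> usage P x (Suc i) j
         else vstate P x (Suc i) j = (2, 0))" for j
    proof (cases "j = b")
      case True
      have "is_open P x i b" if "accepts v"
        using IH1(3)[of b] that not_accepts_initial by (cases "is_open P x i b") (auto simp: v_def)
      then show ?thesis
        using True IH1[of b] u tail_nonneg[of "fst v"] tail_nonneg[of 0]
        by (auto simp: st put_def is_open_Suc usage_Suc b_def v_def simp del: vstate.simps)
    next
      case False
      then show ?thesis using IH1[of j] by (auto simp: st is_open_Suc usage_Suc b_def simp del: vstate.simps)
    qed
    have "\<rho> * ((if accepts v then 0 else 1) - (if is_open P x i b then 0 else 1))
        + (snd (put v (x (Suc i))) - snd v) \<le> 2 * tail (usage P x i b)"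
    proof (cases "accepts v")
      case True
      have "is_open P x i b"
        using IH1(3)[of b] True not_accepts_initial by (cases "is_open P x i b") (auto simp: v_def)
      moreover from this have "tail (fst v) \<le> tail (usage P x i b)"
        using IH1(2) by (intro tail_mono) (simp add: v_def)
      ultimately show ?thesis
        using True tail_nonneg[of "usage P x i b"] by (simp add: put_def)
    next
      case not_acc: False
      show ?thesis
      proof (cases "is_open P x i b")
        case True
        then have *: "fst v \<le> usage P x i b" using IH1(2) by (simp add: v_def)
        then have "\<rho> < snd v + tail (fst v)" using not_acc u by (auto simp: accepts_def)
        moreover have "tail (fst v) \<le> tail (usage P x i b)" using * by (rule tail_mono)
        ultimately show ?thesis using not_acc True t0 by (simp add: put_def)
      next
        case False
        then show ?thesis
          using not_acc IH1(3)[of b] t0 tail_nonneg[of "usage P x i b"] by (simp add: put_def v_def)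
      qed
    qed
    then have "\<rho> * (real (restarts P x (Suc i)) - ?o (Suc i)) + (\<Sum>j\<in>{1..n}. snd (vstate P x (Suc i) j))
        \<le> 2 * (\<Sum>j\<in>{1..n}. bin_risk P x (Suc i) j)"
      using IH2 unfolding sum_snd sum_risk opn rst by (simp only: algebra_simps)
    with states show ?case by blast
  qed simp
  then have "0 \<le> (\<Sum>j\<in>{1..n}. snd (vstate P x n j))"
    by (intro sum_nonneg) simp
  with inv[of n] show ?thesis by (simp add: num_opened_def)
qed

text \<open>
  A feasible policy leaves a bin alone once it is overflowed, so each overflow is caused by exactly
  one item.
\<close>

lemma num_overflowed_eq_sum_rounds:
  assumes P: "is_policy n P"
    and x: "\<And>k. 0 \<le> x k" and feas: "\<And>i. i < n \<Longrightarrow> usage P x i (bin_of P x (Suc i)) \<le> 1"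
  shows "num_overflowed P n x = (\<Sum>i<n. if usage P x (Suc i) (bin_of P x (Suc i)) > 1 then 1 else 0)"
proof -
  have "card {j \<in> {1..n}. overflowed P x i j} =
      (\<Sum>k<i. if usage P x (Suc k) (bin_of P x (Suc k)) > 1 then 1 else 0)" if "i \<le> n" for i
    using that
  proof (induction i)
    case 0
    show ?case by (simp add: overflowed_def usage_def items_in_def)
  next
    case (Suc i)
    define b where "b = bin_of P x (Suc i)"
    have b: "b \<in> {1..n}" using bin_of_range[OF P] Suc.prems by (simp add: b_def)
    have nb: "\<not> overflowed P x i b" using feas[of i] Suc.prems by (simp add: overflowed_def b_def)
    have "{j \<in> {1..n}. overflowed P x (Suc i) j} =
        (if usage P x (Suc i) b > 1 then insert b {j \<in> {1..n}. overflowed P x i j}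
         else {j \<in> {1..n}. overflowed P x i j})"
      using b nb by (auto simp: overflowed_def usage_Suc b_def[symmetric] split: if_splits)
    then have "card {j \<in> {1..n}. overflowed P x (Suc i) j} =
        card {j \<in> {1..n}. overflowed P x i j} + (if usage P x (Suc i) b > 1 then 1 else 0)"
      using nb by simp
    then show ?case using Suc by (simp add: b_def)
  qed
  then show ?thesis by (simp add: num_overflowed_def)
qed

text \<open>
  The rule of Budgeted Greedy along one path, with probabilities expressed by the law \<open>\<mu>\<close>.
\<close>

definition greedy_on :: "policy \<Rightarrow> nat \<Rightarrow> (nat \<Rightarrow> real) \<Rightarrow> bool" where
  "greedy_on P n x \<longleftrightarrow> (\<forall>i<n.
     let b = bin_of P x (Suc i);
         G = {j \<in> {1..n}. is_open P x i j \<and> accepts (usage P x i j, bin_risk P x i j)}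
     in if G \<noteq> {} then b \<in> G else \<not> is_open P x i b)"

lemma greedy_on_accepts:
  assumes "greedy_on P n x" "i < n" "is_open P x i (bin_of P x (Suc i))"
  shows "accepts (usage P x i (bin_of P x (Suc i)), bin_risk P x i (bin_of P x (Suc i)))"
proof -
  let ?G = "{j \<in> {1..n}. is_open P x i j \<and> accepts (usage P x i j, bin_risk P x i j)}"
  have "if ?G \<noteq> {} then bin_of P x (Suc i) \<in> ?G else \<not> is_open P x i (bin_of P x (Suc i))"
    using assms(1,2) unfolding greedy_on_def Let_def by blast
  with assms(3) show ?thesis by (auto split: if_splits)
qed

lemma greedy_on_new_bin:
  assumes "greedy_on P n x" "i < n" "\<not> is_open P x i (bin_of P x (Suc i))"
    "j \<in> {1..n}" "is_open P x i j"
  shows "\<not> accepts (usage P x i j, bin_risk P x i j)"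
proof -
  let ?G = "{j \<in> {1..n}. is_open P x i j \<and> accepts (usage P x i j, bin_risk P x i j)}"
  have "if ?G \<noteq> {} then bin_of P x (Suc i) \<in> ?G else \<not> is_open P x i (bin_of P x (Suc i))"
    using assms(1,2) unfolding greedy_on_def Let_def by blast
  with assms show ?thesis by (auto split: if_splits)
qed

text \<open>
  Greedy opens a bin only when every open bin is closed for further items. The remaining lifetimes
  are then all zero, which makes the inequality for the potential an equality.
\<close>

lemma greedy_on_waste:
  assumes g: "greedy_on P n x" and i: "i < n"
  shows "waste P n x i = 0"
proof (cases "accepts (vstate P x i (bin_of P x (Suc i)))")
  case False
  have st: "vstate P x i j = (if is_open P x i j then (usage P x i j, bin_risk P x i j) else (2, 0))" for j
    using i by (intro vstate_faithful[of n] greedy_on_accepts[OF g]) auto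
  have new: "\<not> is_open P x i (bin_of P x (Suc i))"
    using False greedy_on_accepts[OF g i] by (auto simp: st)
  have "fill_gf (vstate P x i j) = 1" if "j \<in> {1..n}" for j
    using greedy_on_new_bin[OF g i new that]
    by (intro fill_gf_closed) (auto simp: st not_accepts_initial)
  then have "open_gf P n x i = 1" by (simp add: open_gf_def)
  moreover have "(\<Sum>k<n - i. (1 :: real fps) $ k) = 1"
    using i by (simp add: fps_one_nth)
  ultimately show ?thesis using False by (simp add: waste_def)
qed (simp add: waste_def)

text \<open>
  The maximum covers a first item whose risk alone exceeds the budget.
\<close>

lemma greedy_on_bin_risk:
  assumes g: "greedy_on P n x" and "i \<le> n"
  shows "bin_risk P x i j \<le> (if is_open P x i j then max \<rho> (tail 0) else 0)"
  using \<open>i \<le> n\<close>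
proof (induction i)
  case (Suc i)
  show ?case
  proof (cases "bin_of P x (Suc i) = j")
    case True
    then show ?thesis
      using greedy_on_accepts[OF g, of i] Suc.prems
      by (cases "is_open P x i j")
         (auto simp: bin_risk_Suc is_open_Suc accepts_def bin_risk_not_open usage_not_open)
  next
    case False
    with Suc show ?thesis by (simp add: bin_risk_Suc is_open_Suc)
  qed
qed simp

lemma greedy_on_sum_bin_risk:
  assumes "greedy_on P n x"
  shows "(\<Sum>j\<in>{1..n}. bin_risk P x n j) \<le> max \<rho> (tail 0) * real (num_opened P n x)"
proof -
  have "(\<Sum>j\<in>{1..n}. bin_risk P x n j) \<le> (\<Sum>j\<in>{1..n}. if is_open P x n j then max \<rho> (tail 0) else 0)"
    using greedy_on_bin_risk[OF assms order_refl] by (rule sum_mono)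
  also have "\<dots> = (\<Sum>j\<in>{j \<in> {1..n}. is_open P x n j}. max \<rho> (tail 0))"
    by (rule sum.inter_filter[symmetric]) simp
  also have "\<dots> = max \<rho> (tail 0) * real (num_opened P n x)"
    by (simp add: num_opened_def mult.commute)
  finally show ?thesis .
qed

lemma restarts_le: "restarts P x i \<le> i"
  by (induction i) auto

lemma waste_le_1: "waste P n x i \<le> 1"
  using subprob_open_gf[of P n x i]
  by (auto simp: waste_def subprob_fps_def intro!: sum_nonneg)

end

section \<open>Expectations over i.i.d. sizes\<close>

text \<open>
  The law \<open>\<mu>\<close> is a parameter of its own, so that \<open>n = 0\<close>, where no item determines it, is included.
\<close>

locale iid_items = L?: size_law \<mu> \<rho> + prob_space M
  for M :: "'a measure" and X :: "nat \<Rightarrow> 'a \<Rightarrow> real" and n :: nat and \<mu> \<rho> +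
  assumes indep: "indep_vars (\<lambda>_. borel) X {1..n}"
    and law: "\<And>i. i \<in> {1..n} \<Longrightarrow> distr M borel (X i) = \<mu>"
    and nonneg: "\<And>i. i \<in> {1..n} \<Longrightarrow> AE \<omega> in M. 0 \<le> X i \<omega>"
begin

text \<open>
  Sizes with indices outside \<open>{1..n}\<close> may fail to be measurable; they are replaced by 0.
\<close>

definition sizes :: "'a \<Rightarrow> nat \<Rightarrow> real" where
  "sizes \<omega> k = (if k \<in> {1..n} then X k \<omega> else 0)"

lemma measurable_X: "i \<in> {1..n} \<Longrightarrow> X i \<in> borel_measurable M"
  using indep by (auto simp: indep_vars_def)

lemma measurable_sizes: "sizes \<in> M \<rightarrow>\<^sub>M path_space"
proof (rule measurable_PiM_single')
  show "(\<lambda>\<omega>. sizes \<omega> k) \<in> borel_measurable M" for k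
    by (cases "k \<in> {1..n}") (auto simp: sizes_def measurable_X)
qed auto

text \<open>
  Conditional on all other sizes, \<open>X i\<close> has law \<open>\<mu>\<close>. If a functional depends only on the first \<open>i\<close> items,
  the inner integral is its conditional expectation given the history before round \<open>i\<close>.
\<close>

lemma resample:
  assumes i: "i \<in> {1..n}" and g [measurable]: "g \<in> borel_measurable path_space"
    and B: "\<And>x. \<bar>g x :: real\<bar> \<le> B"
  shows "(\<integral>\<omega>. g (sizes \<omega>) \<partial>M) = (\<integral>\<omega>. (\<integral>y. g ((sizes \<omega>)(i := y)) \<partial>\<mu>) \<partial>M)"
proof -
  define A where "A = {1..n} - {i}"
  define Y where "Y \<omega> = restrict (\<lambda>k. X k \<omega>) A" for \<omega>
  define Z where "Z \<omega> = restrict (\<lambda>k. X k \<omega>) {i}" for \<omega>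
  define join where "join = (\<lambda>(a, y) k. if k \<in> A then a k else if k = i then y else (0::real))"
  let ?A = "\<Pi>\<^sub>M k\<in>A. (borel :: real measure)" and ?I = "\<Pi>\<^sub>M k\<in>{i}. (borel :: real measure)"
  have join [measurable]: "join \<in> ?A \<Otimes>\<^sub>M borel \<rightarrow>\<^sub>M path_space"
  proof (rule measurable_PiM_single')
    fix k
    show "(\<lambda>z. join z k) \<in> borel_measurable (?A \<Otimes>\<^sub>M borel)"
      by (cases "k \<in> A"; cases "k = i") (auto simp: join_def case_prod_unfold A_def)
  qed auto
  have ind: "indep_var ?A Y ?I Z"
    unfolding Y_def Z_def using i by (intro indep_var_restrict[OF indep]) (auto simp: A_def)
  then have [measurable]: "Y \<in> M \<rightarrow>\<^sub>M ?A" "Z \<in> M \<rightarrow>\<^sub>M ?I"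
    by (auto dest: indep_var_rv1 indep_var_rv2)
  have [measurable]: "X i \<in> borel_measurable M" using i by (rule measurable_X)
  interpret Y: prob_space "distr M ?A Y" by (rule prob_space_distr) simp
  interpret Z: prob_space "distr M ?I Z" by (rule prob_space_distr) simp
  interpret pair: pair_prob_space "distr M ?A Y" "distr M ?I Z" ..
  have sizes_join: "sizes \<omega> = join (Y \<omega>, Z \<omega> i)" for \<omega>
    using i by (auto simp: sizes_def join_def Y_def Z_def A_def)
  have upd: "(sizes \<omega>)(i := y) = join (Y \<omega>, y)" for \<omega> y
    using i by (auto simp: sizes_def join_def Y_def A_def)
  have "(\<integral>\<omega>. g (sizes \<omega>) \<partial>M) =
      (\<integral>z. g (join (fst z, snd z i)) \<partial>distr M (?A \<Otimes>\<^sub>M ?I) (\<lambda>\<omega>. (Y \<omega>, Z \<omega>)))"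
    by (subst integral_distr) (auto simp: sizes_join)
  also have "distr M (?A \<Otimes>\<^sub>M ?I) (\<lambda>\<omega>. (Y \<omega>, Z \<omega>)) = distr M ?A Y \<Otimes>\<^sub>M distr M ?I Z"
    using ind by (simp add: indep_var_distribution_eq)
  also have "(\<integral>z. g (join (fst z, snd z i)) \<partial>(distr M ?A Y \<Otimes>\<^sub>M distr M ?I Z)) =
      (\<integral>a. (\<integral>b. g (join (a, b i)) \<partial>distr M ?I Z) \<partial>distr M ?A Y)"
    using B by (subst pair.integral_fst'[symmetric]) (auto intro!: pair.integrable_const_bound[where B=B])
  also have "\<dots> = (\<integral>a. (\<integral>y. g (join (a, y)) \<partial>\<mu>) \<partial>distr M ?A Y)"
  proof (rule Bochner_Integration.integral_cong[OF refl])
    fix a assume "a \<in> space (distr M ?A Y)"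
    then have [simp]: "a \<in> space ?A" by simp
    have "(\<integral>b. g (join (a, b i)) \<partial>distr M ?I Z) = (\<integral>\<omega>. g (join (a, X i \<omega>)) \<partial>M)"
      by (subst integral_distr) (auto simp: Z_def)
    also have "\<dots> = (\<integral>y. g (join (a, y)) \<partial>distr M borel (X i))"
      by (subst integral_distr) auto
    finally show "(\<integral>b. g (join (a, b i)) \<partial>distr M ?I Z) = (\<integral>y. g (join (a, y)) \<partial>\<mu>)"
      by (simp add: law[OF i])
  qed
  also have "\<dots> = (\<integral>\<omega>. (\<integral>y. g (join (Y \<omega>, y)) \<partial>\<mu>) \<partial>M)"
    by (subst integral_distr) auto
  finally show ?thesis by (simp add: upd)
qed

lemma integrable_sizes:
  assumes "g \<in> borel_measurable path_space" "\<And>x. \<bar>g x :: real\<bar> \<le> B"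
  shows "integrable M (\<lambda>\<omega>. g (sizes \<omega>))"
  using assms measurable_compose[OF measurable_sizes assms(1)]
  by (intro integrable_const_bound[where B=B]) auto

lemma sizes_nonneg: "AE \<omega> in M. \<forall>k. 0 \<le> sizes \<omega> k"
proof -
  have "AE \<omega> in M. \<forall>k\<in>{1..n}. 0 \<le> X k \<omega>"
    using nonneg by (intro AE_finite_allI) auto
  then show ?thesis by eventually_elim (auto simp: sizes_def)
qed

text \<open>
  Expected potential plus expected number of virtual bins grows in each round by the expected waste.
  It starts at \<open>F\<^sub>n\<close>, as all bins are closed, and ends at the expected number of virtual bins, as no items
  are left.
\<close>

lemma expected_restarts:
  assumes P: "is_policy n P"
  shows "(\<integral>\<omega>. real (restarts P (sizes \<omega>) n) \<partial>M) =
     fresh_gf $ n + (\<Sum>i<n. \<integral>\<omega>. waste P n (sizes \<omega>) i \<partial>M)"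
proof -
  have int_pot: "integrable M (\<lambda>\<omega>. potential P n (sizes \<omega>) i)" if "i \<le> n" for i
    by (rule integrable_sizes[OF measurable_potential[OF P that] potential_bound])
  have int_res: "integrable M (\<lambda>\<omega>. real (restarts P (sizes \<omega>) i))" if "i \<le> n" for i
    by (rule integrable_sizes[OF measurable_restarts[OF P that], where B = "real i"])
       (simp add: restarts_le)
  have int_waste: "integrable M (\<lambda>\<omega>. waste P n (sizes \<omega>) i)" if "i < n" for i
  proof (rule integrable_sizes[OF measurable_waste[OF P that], where B = 1])
    show "\<bar>waste P n x i\<bar> \<le> 1" for x
      using waste_nonneg[OF that, of P x] waste_le_1[of P n x i] by simp
  qed
  have "(\<integral>\<omega>. potential P n (sizes \<omega>) i \<partial>M) + (\<integral>\<omega>. real (restarts P (sizes \<omega>) i) \<partial>M) =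
      fresh_gf $ n + (\<Sum>k<i. \<integral>\<omega>. waste P n (sizes \<omega>) k \<partial>M)" if "i \<le> n" for i
    using that
  proof (induction i)
    case 0
    have "open_gf P n x 0 = 1" for x
      by (simp add: open_gf_def fill_gf_closed not_accepts_initial)
    then show ?case by (simp add: potential_def prob_space)
  next
    case (Suc i)
    then have i: "i < n" by simp
    let ?new = "\<lambda>\<omega>. real (restarts P (sizes \<omega>) (Suc i)) - real (restarts P (sizes \<omega>) i)"
    have "(\<integral>\<omega>. potential P n (sizes \<omega>) (Suc i) \<partial>M) =
        (\<integral>\<omega>. (\<integral>y. potential P n ((sizes \<omega>)(Suc i := y)) (Suc i) \<partial>\<mu>) \<partial>M)"
      using i by (intro resample[OF _ measurable_potential[OF P] potential_bound]) auto
    also have "\<dots> = (\<integral>\<omega>. potential P n (sizes \<omega>) i + waste P n (sizes \<omega>) i - ?new \<omega> \<partial>M)"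
      by (intro Bochner_Integration.integral_cong) (auto simp: potential_step[OF P i])
    also have "\<dots> = (\<integral>\<omega>. potential P n (sizes \<omega>) i \<partial>M) + (\<integral>\<omega>. waste P n (sizes \<omega>) i \<partial>M)
        - ((\<integral>\<omega>. real (restarts P (sizes \<omega>) (Suc i)) \<partial>M) - (\<integral>\<omega>. real (restarts P (sizes \<omega>) i) \<partial>M))"
      using int_pot[of i] int_res[of i] int_res[of "Suc i"] int_waste[of i] i
      by (simp del: restarts.simps)
    finally show ?case using Suc i by simp
  qed
  from this[of n] show ?thesis by (simp add: potential_def)
qed

lemma fresh_le_restarts:
  assumes P: "is_policy n P"
  shows "fresh_gf $ n \<le> (\<integral>\<omega>. real (restarts P (sizes \<omega>) n) \<partial>M)"
  unfolding expected_restarts[OF P]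
  by (simp, intro sum_nonneg Bochner_Integration.integral_nonneg waste_nonneg) simp

lemma sizes_agree: "i \<le> n \<Longrightarrow> k \<in> {1..i} \<Longrightarrow> X k \<omega> = sizes \<omega> k"
  by (auto simp: sizes_def)

lemma expected_opened_sizes: "expected_opened M X n P = (\<integral>\<omega>. real (num_opened P n (sizes \<omega>)) \<partial>M)"
proof -
  have "num_opened P n (\<lambda>k. X k \<omega>) = num_opened P n (sizes \<omega>)" for \<omega>
    unfolding num_opened_def
    by (intro arg_cong[where f = card] Collect_cong conj_cong refl is_open_cong sizes_agree[of n]) auto
  then show ?thesis by (simp add: expected_opened_def)
qed

lemma usage_sizes: "i \<le> n \<Longrightarrow> usage P (\<lambda>k. X k \<omega>) i j = usage P (sizes \<omega>) i j"
  by (intro usage_cong sizes_agree) auto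

lemma bin_of_sizes: "i < n \<Longrightarrow> bin_of P (\<lambda>k. X k \<omega>) (Suc i) = bin_of P (sizes \<omega>) (Suc i)"
  by (intro bin_of_cong sizes_agree[of n]) auto

lemma is_open_sizes: "i \<le> n \<Longrightarrow> is_open P (\<lambda>k. X k \<omega>) i j \<longleftrightarrow> is_open P (sizes \<omega>) i j"
  by (intro is_open_cong sizes_agree) auto

lemma items_in_sizes: "i \<le> n \<Longrightarrow> items_in P (\<lambda>k. X k \<omega>) i j = items_in P (sizes \<omega>) i j"
  by (intro items_in_cong sizes_agree) auto

lemma expected_overflowed_sizes:
  "expected_overflowed M X n P = (\<integral>\<omega>. real (num_overflowed P n (sizes \<omega>)) \<partial>M)"
  by (simp add: expected_overflowed_def num_overflowed_def overflowed_def usage_sizes)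

lemma overflow_prob_eq_tail:
  assumes "k \<in> {1..n}"
  shows "overflow_prob M X k s = tail s"
proof -
  have "tail s = measure (distr M borel (X k)) {y. y + s > 1}"
    by (simp add: tail_def law[OF assms])
  also have "\<dots> = overflow_prob M X k s"
    unfolding overflow_prob_def using measurable_X[OF assms]
    by (subst measure_distr) (auto intro!: arg_cong[where f = "measure M"])
  finally show ?thesis ..
qed

lemma risk_sizes:
  assumes "i \<le> n"
  shows "risk M X P (\<lambda>k. X k \<omega>) i j = bin_risk P (sizes \<omega>) i j"
  unfolding risk_def bin_risk_def
proof (intro sum.cong items_in_sizes assms)
  fix k assume "k \<in> items_in P (sizes \<omega>) i j"
  then have "k \<in> {1..n}" using assms by (auto simp: items_in_def)
  then show "overflow_prob M X k (usage P (\<lambda>k. X k \<omega>) (k - 1) j) = tail (usage P (sizes \<omega>) (k - 1) j)"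
    using usage_sizes[of "k - 1"] by (auto simp: overflow_prob_eq_tail intro!: arg_cong[where f = tail])
qed

lemma round_shift: "(\<forall>i\<in>{1..n}. R i) \<longleftrightarrow> (\<forall>i<n. R (Suc i))"
  by (metis Suc_le_eq atLeastAtMost_iff le_add1 not0_implies_Suc not_one_le_zero plus_1_eq_Suc)

lemma feasible_sizes:
  assumes "feasible M X n P"
  shows "AE \<omega> in M. \<forall>i<n. usage P (sizes \<omega>) i (bin_of P (sizes \<omega>) (Suc i)) \<le> 1"
  using assms unfolding feasible_def Let_def round_shift
  by (auto simp: overflowed_def bin_of_sizes usage_sizes not_less elim!: AE_mp)

lemma greedy_sizes:
  assumes "budgeted_greedy M X C n \<gamma> P" and \<rho>: "\<rho> = \<gamma> / C"
  shows "AE \<omega> in M. greedy_on P n (sizes \<omega>)"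
proof -
  have G: "greedy_bins M X C n \<gamma> P (\<lambda>k. X k \<omega>) (Suc i) =
      {j \<in> {1..n}. is_open P (sizes \<omega>) i j \<and> accepts (usage P (sizes \<omega>) i j, bin_risk P (sizes \<omega>) i j)}"
    if "i < n" for \<omega> i
    using that
    by (auto simp: greedy_bins_def overflowed_def is_open_sizes usage_sizes risk_sizes
        overflow_prob_eq_tail accepts_def not_less \<rho>[symmetric])
  have "AE \<omega> in M. \<forall>i<n. let x = \<lambda>k. X k \<omega>; b = bin_of P x (Suc i);
      G = greedy_bins M X C n \<gamma> P x (Suc i) in if G \<noteq> {} then b \<in> G else \<not> is_open P x i b"
    using assms(1) unfolding budgeted_greedy_def Let_def round_shift diff_Suc_1 by (rule conjunct2)
  then show ?thesis
  proof eventually_elim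
    case (elim \<omega>)
    show ?case
      unfolding greedy_on_def Let_def
    proof (intro allI impI)
      fix i assume i: "i < n"
      show "if {j \<in> {1..n}. is_open P (sizes \<omega>) i j \<and>
            accepts (usage P (sizes \<omega>) i j, bin_risk P (sizes \<omega>) i j)} \<noteq> {}
          then bin_of P (sizes \<omega>) (Suc i) \<in> {j \<in> {1..n}. is_open P (sizes \<omega>) i j \<and>
            accepts (usage P (sizes \<omega>) i j, bin_risk P (sizes \<omega>) i j)}
          else \<not> is_open P (sizes \<omega>) i (bin_of P (sizes \<omega>) (Suc i))"
        using elim[unfolded Let_def, rule_format, OF i]
        unfolding G[OF i] bin_of_sizes[OF i] is_open_sizes[OF less_imp_le[OF i]] .
    qed
  qed
qed

lemma greedy_feasible:
  assumes "budgeted_greedy M X C n \<gamma> P" and \<rho>: "\<rho> = \<gamma> / C"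
  shows "feasible M X n P"
  unfolding feasible_def
proof
  show "is_policy n P" using assms by (simp add: budgeted_greedy_def)
  have "AE \<omega> in M. \<forall>i<n. \<not> overflowed P (\<lambda>k. X k \<omega>) i (bin_of P (\<lambda>k. X k \<omega>) (Suc i))"
    using greedy_sizes[OF assms]
  proof eventually_elim
    case (elim \<omega>)
    show ?case
    proof (intro allI impI)
      fix i assume i: "i < n"
      let ?b = "bin_of P (sizes \<omega>) (Suc i)"
      have "usage P (sizes \<omega>) i ?b \<le> 1"
        using greedy_on_accepts[OF elim i] usage_not_open[of P "sizes \<omega>" i ?b]
        by (cases "is_open P (sizes \<omega>) i ?b") (auto simp: accepts_def)
      then show "\<not> overflowed P (\<lambda>k. X k \<omega>) i (bin_of P (\<lambda>k. X k \<omega>) (Suc i))"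
        using i by (simp add: overflowed_def bin_of_sizes usage_sizes)
    qed
  qed
  then show "AE \<omega> in M. let x = \<lambda>k. X k \<omega> in \<forall>i\<in>{1..n}. \<not> overflowed P x (i - 1) (bin_of P x i)"
    unfolding Let_def round_shift by simp
qed

lemma expected_opened_greedy:
  assumes "budgeted_greedy M X C n \<gamma> P" and \<rho>: "\<rho> = \<gamma> / C"
  shows "expected_opened M X n P = fresh_gf $ n"
proof -
  have P: "is_policy n P" using assms by (simp add: budgeted_greedy_def)
  note g = greedy_sizes[OF assms]
  have "expected_opened M X n P = (\<integral>\<omega>. real (restarts P (sizes \<omega>) n) \<partial>M)"
    unfolding expected_opened_sizes
  proof (rule integral_cong_AE)
    show "AE \<omega> in M. real (num_opened P n (sizes \<omega>)) = real (restarts P (sizes \<omega>) n)"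
      using g by eventually_elim (simp add: restarts_faithful[OF P greedy_on_accepts])
  qed (auto intro!: measurable_compose[OF measurable_sizes] measurable_num_opened measurable_restarts P)
  also have "\<dots> = fresh_gf $ n + (\<Sum>i<n. \<integral>\<omega>. waste P n (sizes \<omega>) i \<partial>M)"
    by (rule expected_restarts[OF P])
  also have "(\<integral>\<omega>. waste P n (sizes \<omega>) i \<partial>M) = 0" if "i < n" for i
    using g by (intro integral_eq_zero_AE) (auto elim!: AE_mp simp: greedy_on_waste[OF _ that])
  then have "(\<Sum>i<n. \<integral>\<omega>. waste P n (sizes \<omega>) i \<partial>M) = 0" by simp
  finally show ?thesis by simp
qed

lemma fresh_le_risk_budgeted:
  assumes "risk_budgeted M X n \<rho> P"
  shows "fresh_gf $ n \<le> expected_opened M X n P"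
proof -
  have f: "feasible M X n P" and P: "is_policy n P"
    and r: "AE \<omega> in M. \<forall>j\<in>{1..n}. risk M X P (\<lambda>k. X k \<omega>) n j \<le> \<rho>"
    using assms by (auto simp: risk_budgeted_def feasible_def)
  have "(\<integral>\<omega>. real (restarts P (sizes \<omega>) n) \<partial>M) = expected_opened M X n P"
    unfolding expected_opened_sizes
  proof (rule integral_cong_AE)
    show "AE \<omega> in M. real (restarts P (sizes \<omega>) n) = real (num_opened P n (sizes \<omega>))"
      using feasible_sizes[OF f] r
    proof eventually_elim
      case (elim \<omega>)
      have "accepts (usage P (sizes \<omega>) i b, bin_risk P (sizes \<omega>) i b)"
        if i: "i < n" and b: "b = bin_of P (sizes \<omega>) (Suc i)" for i b
      proof -
        have "b \<in> {1..n}" using bin_of_range[OF P] i b by simp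
        then have "bin_risk P (sizes \<omega>) n b \<le> \<rho>" using elim(2) by (simp add: risk_sizes)
        moreover have "bin_risk P (sizes \<omega>) (Suc i) b \<le> bin_risk P (sizes \<omega>) n b"
          using i by (intro bin_risk_mono) simp
        ultimately show ?thesis using elim(1) i b by (simp add: accepts_def bin_risk_Suc)
      qed
      then show ?case by (simp add: restarts_faithful[OF P])
    qed
  qed (auto intro!: measurable_compose[OF measurable_sizes] measurable_num_opened measurable_restarts P)
  then show ?thesis using fresh_le_restarts[OF P] by simp
qed

lemma measurable_chosen_usage:
  assumes P: "is_policy n P" and i: "i < n" and k: "k \<le> n"
  shows "(\<lambda>x. usage P x k (bin_of P x (Suc i))) \<in> borel_measurable path_space"
  using i by (intro measurable_compose_countable[OF measurable_usage[OF P k] measurable_bin_of[OF P]]) auto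

text \<open>
  Given the history, an item overflows its bin with probability equal to the risk that it adds.
\<close>

lemma expected_overflowed_eq_risk:
  assumes f: "feasible M X n P"
  shows "expected_overflowed M X n P = (\<integral>\<omega>. (\<Sum>j\<in>{1..n}. bin_risk P (sizes \<omega>) n j) \<partial>M)"
    and "integrable M (\<lambda>\<omega>. \<Sum>j\<in>{1..n}. bin_risk P (sizes \<omega>) n j)"
proof -
  have P: "is_policy n P" using f by (simp add: feasible_def)
  let ?hit = "\<lambda>i x. (if usage P x (Suc i) (bin_of P x (Suc i)) > 1 then 1 else 0) :: real"
  let ?t = "\<lambda>i x. tail (usage P x i (bin_of P x (Suc i)))"
  have m_hit: "?hit i \<in> borel_measurable path_space" if "i < n" for i
  proof -
    have [measurable]: "(\<lambda>x. usage P x (Suc i) (bin_of P x (Suc i))) \<in> borel_measurable path_space"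
      using that by (intro measurable_chosen_usage[OF P that]) simp
    show ?thesis by measurable
  qed
  have m_t: "?t i \<in> borel_measurable path_space" if "i < n" for i
    using that by (intro measurable_compose[OF measurable_chosen_usage[OF P that] measurable_tail]) simp
  have int_hit: "integrable M (\<lambda>\<omega>. ?hit i (sizes \<omega>))" if "i < n" for i
    by (rule integrable_sizes[OF m_hit[OF that], where B = 1]) simp
  have int_t: "integrable M (\<lambda>\<omega>. ?t i (sizes \<omega>))" if "i < n" for i
    by (rule integrable_sizes[OF m_t[OF that], where B = 1]) (simp add: tail_nonneg tail_le_1)
  have hit: "(\<integral>\<omega>. ?hit i (sizes \<omega>) \<partial>M) = (\<integral>\<omega>. ?t i (sizes \<omega>) \<partial>M)" if i: "i < n" for i
  proof -
    have "(\<integral>y. ?hit i (x(Suc i := y)) \<partial>\<mu>) = ?t i x" for x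
    proof -
      let ?b = "bin_of P x (Suc i)"
      have b: "bin_of P (x(Suc i := y)) (Suc i) = ?b" for y
        by (intro bin_of_cong) auto
      have "usage P (x(Suc i := y)) i ?b = usage P x i ?b" for y
        by (intro usage_cong) auto
      then have "?hit i (x(Suc i := y)) = indicator {y. y + usage P x i ?b > 1} y" for y
        by (simp add: usage_Suc b add.commute indicator_def)
      then show ?thesis by (simp add: tail_def)
    qed
    moreover have "(\<integral>\<omega>. ?hit i (sizes \<omega>) \<partial>M) = (\<integral>\<omega>. (\<integral>y. ?hit i ((sizes \<omega>)(Suc i := y)) \<partial>\<mu>) \<partial>M)"
      using i by (intro resample[OF _ m_hit, where B = 1]) auto
    ultimately show ?thesis by simp
  qed
  show "integrable M (\<lambda>\<omega>. \<Sum>j\<in>{1..n}. bin_risk P (sizes \<omega>) n j)"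
    unfolding sum_bin_risk[OF P order_refl]
    using int_t by (intro Bochner_Integration.integrable_sum) auto
  have "expected_overflowed M X n P = (\<integral>\<omega>. (\<Sum>i<n. ?hit i (sizes \<omega>)) \<partial>M)"
    unfolding expected_overflowed_sizes
  proof (rule integral_cong_AE)
    show "AE \<omega> in M. real (num_overflowed P n (sizes \<omega>)) = (\<Sum>i<n. ?hit i (sizes \<omega>))"
      using feasible_sizes[OF f] sizes_nonneg
      by eventually_elim (simp add: num_overflowed_eq_sum_rounds[OF P] if_distrib cong: if_cong)
  next
    show "(\<lambda>\<omega>. real (num_overflowed P n (sizes \<omega>))) \<in> borel_measurable M"
      by (rule measurable_compose[OF measurable_sizes measurable_num_overflowed[OF P]])
    show "(\<lambda>\<omega>. \<Sum>i<n. ?hit i (sizes \<omega>)) \<in> borel_measurable M"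
      using int_hit by (intro borel_measurable_sum) auto
  qed
  also have "\<dots> = (\<Sum>i<n. \<integral>\<omega>. ?hit i (sizes \<omega>) \<partial>M)"
    using int_hit by (intro Bochner_Integration.integral_sum) auto
  also have "\<dots> = (\<Sum>i<n. \<integral>\<omega>. ?t i (sizes \<omega>) \<partial>M)"
    using hit by simp
  also have "\<dots> = (\<integral>\<omega>. (\<Sum>i<n. ?t i (sizes \<omega>)) \<partial>M)"
    using int_t by (intro Bochner_Integration.integral_sum[symmetric]) auto
  finally show "expected_overflowed M X n P = (\<integral>\<omega>. (\<Sum>j\<in>{1..n}. bin_risk P (sizes \<omega>) n j) \<partial>M)"
    unfolding sum_bin_risk[OF P order_refl] .
qed

lemma integrable_num_opened:
  assumes "is_policy n P"
  shows "integrable M (\<lambda>\<omega>. real (num_opened P n (sizes \<omega>)))"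
proof (rule integrable_sizes[OF measurable_num_opened[OF assms], where B = "real n"])
  have "card {j \<in> {1..n}. is_open P x n j} \<le> card {1..n}" for x
    by (intro card_mono) auto
  then show "\<bar>real (num_opened P n x)\<bar> \<le> real n" for x by (simp add: num_opened_def)
qed

lemma fresh_le_opened_plus_overflowed:
  assumes f: "feasible M X n P" and \<rho>: "0 < \<rho>"
  shows "fresh_gf $ n \<le> expected_opened M X n P + 2 / \<rho> * expected_overflowed M X n P"
proof -
  have P: "is_policy n P" using f by (simp add: feasible_def)
  note int = integrable_num_opened[OF P] expected_overflowed_eq_risk(2)[OF f]
  have "(\<integral>\<omega>. real (restarts P (sizes \<omega>) n) \<partial>M) \<le>
      (\<integral>\<omega>. real (num_opened P n (sizes \<omega>)) + 2 / \<rho> * (\<Sum>j\<in>{1..n}. bin_risk P (sizes \<omega>) n j) \<partial>M)"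
  proof (rule integral_mono_AE)
    show "integrable M (\<lambda>\<omega>. real (restarts P (sizes \<omega>) n))"
      by (rule integrable_sizes[OF measurable_restarts[OF P order_refl], where B = "real n"])
         (simp add: restarts_le)
    show "AE \<omega> in M. real (restarts P (sizes \<omega>) n) \<le>
        real (num_opened P n (sizes \<omega>)) + 2 / \<rho> * (\<Sum>j\<in>{1..n}. bin_risk P (sizes \<omega>) n j)"
      using feasible_sizes[OF f] sizes_nonneg
    proof eventually_elim
      case (elim \<omega>)
      then show ?case
        using restarts_le_opened_plus_risk[OF P, of "sizes \<omega>"] \<rho> by (simp add: field_simps)
    qed
  qed (use int in simp)
  also have "\<dots> = expected_opened M X n P + 2 / \<rho> * expected_overflowed M X n P"
    using int by (simp add: expected_opened_sizes expected_overflowed_eq_risk(1)[OF f])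
  finally show ?thesis using fresh_le_restarts[OF P] by simp
qed

lemma expected_overflowed_greedy_le:
  assumes g: "budgeted_greedy M X C n \<gamma> P" and \<rho>: "\<rho> = \<gamma> / C"
  shows "expected_overflowed M X n P \<le> max \<rho> (tail 0) * expected_opened M X n P"
proof -
  have P: "is_policy n P" using g by (simp add: budgeted_greedy_def)
  note f = greedy_feasible[OF assms]
  have "(\<integral>\<omega>. (\<Sum>j\<in>{1..n}. bin_risk P (sizes \<omega>) n j) \<partial>M)
      \<le> (\<integral>\<omega>. max \<rho> (tail 0) * real (num_opened P n (sizes \<omega>)) \<partial>M)"
  proof (rule integral_mono_AE)
    show "AE \<omega> in M. (\<Sum>j\<in>{1..n}. bin_risk P (sizes \<omega>) n j)
        \<le> max \<rho> (tail 0) * real (num_opened P n (sizes \<omega>))"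
      using greedy_sizes[OF assms] by eventually_elim (rule greedy_on_sum_bin_risk)
  qed (use integrable_num_opened[OF P] expected_overflowed_eq_risk(2)[OF f] in simp_all)
  then show ?thesis
    by (simp add: expected_overflowed_eq_risk(1)[OF f] expected_opened_sizes)
qed

text \<open>
  Usages are nonnegative and \<open>tail\<close> is monotone, so each item adds at least the risk \<open>tail 0\<close>.
\<close>

lemma expected_overflowed_ge:
  assumes f: "feasible M X n P"
  shows "real n * tail 0 \<le> expected_overflowed M X n P"
proof -
  have P: "is_policy n P" using f by (simp add: feasible_def)
  have "(\<integral>\<omega>. real n * tail 0 \<partial>M) \<le> (\<integral>\<omega>. (\<Sum>j\<in>{1..n}. bin_risk P (sizes \<omega>) n j) \<partial>M)"
  proof (rule integral_mono_AE)
    show "AE \<omega> in M. real n * tail 0 \<le> (\<Sum>j\<in>{1..n}. bin_risk P (sizes \<omega>) n j)"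
      using sizes_nonneg
    proof eventually_elim
      case (elim \<omega>)
      have "(\<Sum>i<n. tail 0) \<le> (\<Sum>i<n. tail (usage P (sizes \<omega>) i (bin_of P (sizes \<omega>) (Suc i))))"
        using elim by (intro sum_mono tail_mono usage_nonneg) auto
      then show ?case using sum_bin_risk[OF P order_refl, of "sizes \<omega>"] by simp
    qed
  qed (use expected_overflowed_eq_risk(2)[OF f] in simp_all)
  then show ?thesis by (simp add: expected_overflowed_eq_risk(1)[OF f] prob_space)
qed

lemma expected_opened_le:
  assumes "is_policy n P"
  shows "expected_opened M X n P \<le> real n"
  unfolding expected_opened_sizes
proof (rule integral_le_const[OF integrable_num_opened[OF assms]])
  have "card {j \<in> {1..n}. is_open P x n j} \<le> card {1..n}" for x
    by (intro card_mono) auto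
  then show "AE \<omega> in M. real (num_opened P n (sizes \<omega>)) \<le> real n" by (simp add: num_opened_def)
qed

text \<open>
  If \<open>tail 0 \<le> \<rho>\<close>, the bound on the number of bins of Budgeted Greedy also bounds its overflows. Otherwise
  its overflows number at most \<open>n * tail 0\<close> in expectation, which every feasible policy incurs as well.
\<close>

lemma greedy_cost_le:
  assumes g: "budgeted_greedy M X C n (sqrt 2) A" and \<rho>: "\<rho> = sqrt 2 / C" and C: "C \<ge> 1"
    and f: "feasible M X n P"
  shows "cost M X C n A \<le> (2 + sqrt 2) * cost M X C n P"
proof -
  define NA where "NA = expected_opened M X n A"
  define OA where "OA = expected_overflowed M X n A"
  define NP where "NP = expected_opened M X n P"
  define OP where "OP = expected_overflowed M X n P"
  have nn: "0 \<le> NA" "0 \<le> NP" "0 \<le> OP"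
    by (simp_all add: NA_def NP_def OP_def expected_opened_def expected_overflowed_def)
  have "0 < \<rho>" using C \<rho> by simp
  have "2 / \<rho> = sqrt 2 * C" using C by (simp add: \<rho> real_div_sqrt field_simps)
  then have N: "NA \<le> NP + sqrt 2 * C * OP"
    using fresh_le_opened_plus_overflowed[OF f \<open>0 < \<rho>\<close>] expected_opened_greedy[OF g \<rho>]
    by (simp add: NA_def NP_def OP_def)
  have O: "OA \<le> max \<rho> (tail 0) * NA"
    using expected_overflowed_greedy_le[OF g \<rho>] by (simp add: OA_def NA_def)
  have s: "1 \<le> sqrt (2 :: real)" by simp
  have "NA + C * OA \<le> (2 + sqrt 2) * (NP + C * OP)"
  proof (cases "tail 0 \<le> \<rho>")
    case True
    then have "C * OA \<le> C * (\<rho> * NA)" using O C by (intro mult_left_mono) (auto simp: max_def)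
    then have "NA + C * OA \<le> (1 + sqrt 2) * NA" using C by (simp add: \<rho> algebra_simps)
    also have "\<dots> \<le> (1 + sqrt 2) * (sqrt 2 * (NP + C * OP))"
    proof (intro mult_left_mono)
      have "1 * NP \<le> sqrt 2 * NP" using s nn by (intro mult_right_mono)
      with N show "NA \<le> sqrt 2 * (NP + C * OP)" by (simp add: algebra_simps)
    qed simp
    also have "\<dots> = (2 + sqrt 2) * (NP + C * OP)" by (simp add: algebra_simps)
    finally show ?thesis .
  next
    case False
    have "OA \<le> tail 0 * NA" using O False by (simp add: max_def)
    also have "\<dots> \<le> tail 0 * real n"
      using expected_opened_le[of A] g tail_nonneg
      by (intro mult_left_mono) (auto simp: NA_def budgeted_greedy_def)
    also have "\<dots> \<le> OP"
      using expected_overflowed_ge[OF f] by (simp add: OP_def mult.commute)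
    finally have "C * OA \<le> C * OP" using C by simp
    moreover have "0 \<le> C * OP" "0 \<le> sqrt 2 * NP" using nn C by auto
    moreover have "NA \<le> NP + sqrt 2 * (C * OP)" using N by (simp only: mult.assoc)
    ultimately have "NA + C * OA \<le> 2 * NP + (sqrt 2 * NP + (2 * (C * OP) + sqrt 2 * (C * OP)))"
      using nn by linarith
    then show ?thesis by (simp add: algebra_simps)
  qed
  then show ?thesis by (simp add: cost_def NA_def OA_def NP_def OP_def)
qed

end

theorem theorem1p2:
  fixes M :: "'a measure" and X :: "nat \<Rightarrow> 'a \<Rightarrow> real"
    and C :: real and n :: nat and ALG :: policy
  assumes "prob_space M"
    and "C \<ge> 1"
    and "prob_space.indep_vars M (\<lambda>_. borel) X {1..n}"
    and "\<forall>i\<in>{1..n}. \<forall>j\<in>{1..n}. distr M borel (X i) = distr M borel (X j)"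
    and "\<forall>i\<in>{1..n}. AE \<omega> in M. 0 \<le> X i \<omega>"
    and "budgeted_greedy M X C n (sqrt 2) ALG"
  shows "(\<forall>P. risk_budgeted M X n (sqrt 2 / C) P \<longrightarrow>
            expected_opened M X n ALG \<le> expected_opened M X n P) \<and>
         cost M X C n ALG \<le> (3 + 2 * sqrt 2) * cost_opt M X C n"
proof -
  interpret prob_space M by fact
  \<comment> \<open>For \<open>n = 0\<close> there is no item, and any law will do.\<close>
  define \<mu> where "\<mu> = (if n = 0 then return borel 0 else distr M borel (X 1))"
  have meas: "X i \<in> borel_measurable M" if "i \<in> {1..n}" for i
    using assms(3) that by (auto simp: indep_vars_def)
  have \<mu>: "prob_space \<mu>" "sets \<mu> = sets borel"
    using meas[of 1] by (auto simp: \<mu>_def intro!: prob_space_return prob_space_distr)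
  interpret iid_items M X n \<mu> "sqrt 2 / C"
  proof (intro iid_items.intro size_law.intro size_law_axioms.intro iid_items_axioms.intro)
    show "distr M borel (X i) = \<mu>" if "i \<in> {1..n}" for i
    proof -
      have "\<mu> = distr M borel (X 1)" using that by (auto simp: \<mu>_def)
      moreover have "1 \<in> {1..n}" using that by auto
      ultimately show ?thesis using assms(4) that by metis
    qed
  qed (use assms \<mu> in auto)
  show ?thesis
  proof (intro conjI allI impI)
    show "expected_opened M X n ALG \<le> expected_opened M X n P"
      if "risk_budgeted M X n (sqrt 2 / C) P" for P
      using expected_opened_greedy[OF assms(6) refl] fresh_le_risk_budgeted[OF that] by simp
    have "cost M X C n ALG / (2 + sqrt 2) \<le> cost_opt M X C n"
      unfolding cost_opt_def
    proof (rule cINF_greatest)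
      show "{P. feasible M X n P} \<noteq> {}"
        using greedy_feasible[OF assms(6) refl] by auto
      show "cost M X C n ALG / (2 + sqrt 2) \<le> cost M X C n P" if "P \<in> {P. feasible M X n P}" for P
        using greedy_cost_le[OF assms(6) refl assms(2), of P] that
        by (simp add: pos_divide_le_eq add_pos_pos mult.commute)
    qed
    moreover have "0 \<le> cost M X C n ALG / (2 + sqrt 2)"
      using assms(2) by (simp add: cost_def expected_opened_def expected_overflowed_def)
    ultimately have opt: "0 \<le> cost_opt M X C n"
      and le: "cost M X C n ALG / (2 + sqrt 2) \<le> cost_opt M X C n"
      by (auto intro: order_trans)
    have "cost M X C n ALG \<le> (2 + sqrt 2) * cost_opt M X C n"
      using le by (simp add: pos_divide_le_eq add_pos_pos mult.commute)
    also have "\<dots> \<le> (3 + 2 * sqrt 2) * cost_opt M X C n"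
      using opt by (intro mult_right_mono) auto
    finally show "cost M X C n ALG \<le> (3 + 2 * sqrt 2) * cost_opt M X C n" .
  qed
qed

end
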